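(* Let $A$ be an algebra with a right action $(a,\gamma)\mapsto a\cdot\gamma$ of a group $\Gamma$ by automorphisms, and let $j:\Gamma\to Z(A)\cap A^*$ be a $1$-cocycle. 1. The map $\sigma:A\rtimes\Gamma\to A\rtimes\Gamma$ given by $$\sigma(a\otimes\gamma)=\big((j\gamma^{-1})\cdot\gamma\big)a\otimes\gamma$$ is an automorphism. 2. Let $\delta:A\to A$ be a derivation such that $\delta(a\cdot\gamma)=(\delta(a)\cdot\gamma)\,j\gamma$ for all $a\in A$, $\gamma\in\Gamma$. Then for any $s=1,2,\dots$, the map $\delta'_s:A\rtimes\Gamma\to A\rtimes\Gamma$ defined by $$\delta'_s(a\otimes\gamma)=\Big(\delta\big((a\cdot\gamma^{-1})(j\gamma^{-1})^s\big)(j\gamma^{-1})^{-s}\otimes 1\Big)\Big(1\otimes\gamma\Big)$$ is a $\sigma$-derivation on $A\rtimes\Gamma$. Also $\delta'_s\circ\sigma=\sigma\circ\delta'_s$ if $\delta\circ j=0$. 3. Let $\delta$ and $\delta'_s$ be as in part 2. If $\tau:A\to\mathbb{C}$ is a trace such that $\tau\circ\delta=0$, then $\tau'\circ\delta'_s=0$, where the linear functional $\tau':A\rtimes\Gamma\to\mathbb{C}$ is defined by $\tau'(a\otimes\gamma)=0$ if $\gamma\neq 1$ and $\tau'(a\otimes 1)=\tau(a)$. Also, if $\tau$ has the change of variable property with respect to $j$, then $\tau'$ is a $\sigma$-trace on $A\rtimes\Gamma$.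
   Context: Algebras are associative, unital, not necessarily commutative, over $\mathbb{C}$. $Z(A)$ is the center of $A$ and $A^*$ its group of invertible elements. The algebraic crossed product $A\rtimes\Gamma$ is $A\otimes\mathbb{C}\Gamma$ as a vector space, with multiplication $(a\otimes\gamma)(b\otimes\mu)=(a\cdot\mu)b\otimes\gamma\mu$ for $a,b\in A$, $\gamma,\mu\in\Gamma$. A map $j:\Gamma\to Z(A)\cap A^*$ is a $1$-cocycle if $j(\gamma\mu)=\big((j\gamma)\cdot\mu\big)\,j\mu$ for all $\gamma,\mu\in\Gamma$. A linear functional $\tau:A\to\mathbb{C}$ has the change of variable property with respect to $j$ if $\tau((a\cdot\gamma)\,j\gamma)=\tau(a)$ for all $a\in A$, $\gamma\in\Gamma$. For an automorphism $\sigma$ of an algebra $B$: a $\sigma$-derivation on $B$ is a linear map $\delta:B\to B$ with $\delta(xy)=\delta(x)y+\sigma(x)\delta(y)$; a $\sigma$-trace on $B$ is a linear map $\varphi:B\to\mathbb{C}$ with $\varphi(xy)=\varphi(\sigma(y)x)$. Maps on $A\rtimes\Gamma$ given on elements $a\otimes\gamma$ are extended linearly. The condition $\delta\circ j=0$ means $\delta(j\gamma)=0$ for all $\gamma\in\Gamma$. *)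

theory Defs
  imports Complex_Main "HOL-Algebra.QuotRing" "HOL-Algebra.Module"
begin

section \<open>Unital complex algebras\<close>

text \<open>The field of complex numbers, as a ring (of scalars) and as a module over itself.\<close>

definition complexes :: "(complex, complex) module" where
  "complexes = \<lparr>carrier = UNIV, monoid.mult = (*), one = 1, zero = 0, add = (+), smult = (*)\<rparr>"

text \<open>
  \<open>algebra\<close> of \<open>HOL-Algebra.Module\<close> is commutative, so it does not apply here. The zero algebra
  is allowed.
\<close>

locale complex_algebra = ring A + C: module complexes A for A (structure) +
  assumes smult_mult_left:
      "\<lbrakk>x \<in> carrier A; y \<in> carrier A\<rbrakk> \<Longrightarrow> (c \<odot> x) \<otimes> y = c \<odot> (x \<otimes> y)"
    and smult_mult_right:
      "\<lbrakk>x \<in> carrier A; y \<in> carrier A\<rbrakk> \<Longrightarrow> x \<otimes> (c \<odot> y) = c \<odot> (x \<otimes> y)"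

definition linear_map ::
    "(complex, 'a, 'm) module_scheme \<Rightarrow> (complex, 'b, 'n) module_scheme \<Rightarrow> ('a \<Rightarrow> 'b) \<Rightarrow> bool" where
  "linear_map V W f \<longleftrightarrow>
     f \<in> carrier V \<rightarrow> carrier W \<and>
     (\<forall>x\<in>carrier V. \<forall>y\<in>carrier V. f (x \<oplus>\<^bsub>V\<^esub> y) = f x \<oplus>\<^bsub>W\<^esub> f y) \<and>
     (\<forall>c. \<forall>x\<in>carrier V. f (c \<odot>\<^bsub>V\<^esub> x) = c \<odot>\<^bsub>W\<^esub> f x)"

definition algebra_automorphism :: "(complex, 'a, 'm) module_scheme \<Rightarrow> ('a \<Rightarrow> 'a) \<Rightarrow> bool" where
  "algebra_automorphism B \<sigma> \<longleftrightarrow> linear_map B B \<sigma> \<and> \<sigma> \<in> ring_iso B B"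

definition alg_center :: "('a, 'm) ring_scheme \<Rightarrow> 'a set" where
  "alg_center A = {z \<in> carrier A. \<forall>a\<in>carrier A. z \<otimes>\<^bsub>A\<^esub> a = a \<otimes>\<^bsub>A\<^esub> z}"

definition sigma_derivation ::
    "(complex, 'a, 'm) module_scheme \<Rightarrow> ('a \<Rightarrow> 'a) \<Rightarrow> ('a \<Rightarrow> 'a) \<Rightarrow> bool" where
  "sigma_derivation B \<sigma> \<delta> \<longleftrightarrow>
     linear_map B B \<delta> \<and>
     (\<forall>x\<in>carrier B. \<forall>y\<in>carrier B.
        \<delta> (x \<otimes>\<^bsub>B\<^esub> y) = \<delta> x \<otimes>\<^bsub>B\<^esub> y \<oplus>\<^bsub>B\<^esub> \<sigma> x \<otimes>\<^bsub>B\<^esub> \<delta> y)"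

definition sigma_trace ::
    "(complex, 'a, 'm) module_scheme \<Rightarrow> ('a \<Rightarrow> 'a) \<Rightarrow> ('a \<Rightarrow> complex) \<Rightarrow> bool" where
  "sigma_trace B \<sigma> \<phi> \<longleftrightarrow>
     linear_map B complexes \<phi> \<and>
     (\<forall>x\<in>carrier B. \<forall>y\<in>carrier B. \<phi> (x \<otimes>\<^bsub>B\<^esub> y) = \<phi> (\<sigma> y \<otimes>\<^bsub>B\<^esub> x))"

abbreviation derivation :: "(complex, 'a, 'm) module_scheme \<Rightarrow> ('a \<Rightarrow> 'a) \<Rightarrow> bool" where
  "derivation A \<equiv> sigma_derivation A (\<lambda>x. x)"

abbreviation alg_trace :: "(complex, 'a, 'm) module_scheme \<Rightarrow> ('a \<Rightarrow> complex) \<Rightarrow> bool" where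
  "alg_trace A \<equiv> sigma_trace A (\<lambda>x. x)"

section \<open>Right actions, cocycles and the change of variable property\<close>

text \<open>The action is written \<open>act a \<gamma>\<close> for \<open>a \<cdot> \<gamma>\<close>.\<close>

definition right_action ::
    "(complex, 'a, 'm) module_scheme \<Rightarrow> ('g, 'n) monoid_scheme \<Rightarrow> ('a \<Rightarrow> 'g \<Rightarrow> 'a) \<Rightarrow> bool" where
  "right_action A G act \<longleftrightarrow>
     (\<forall>\<gamma>\<in>carrier G. algebra_automorphism A (\<lambda>a. act a \<gamma>)) \<and>
     (\<forall>a\<in>carrier A. act a \<one>\<^bsub>G\<^esub> = a) \<and>
     (\<forall>a\<in>carrier A. \<forall>\<gamma>\<in>carrier G. \<forall>\<mu>\<in>carrier G. act (act a \<gamma>) \<mu> = act a (\<gamma> \<otimes>\<^bsub>G\<^esub> \<mu>))"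

definition one_cocycle ::
    "('a, 'm) ring_scheme \<Rightarrow> ('g, 'n) monoid_scheme \<Rightarrow> ('a \<Rightarrow> 'g \<Rightarrow> 'a) \<Rightarrow> ('g \<Rightarrow> 'a) \<Rightarrow> bool" where
  "one_cocycle A G act j \<longleftrightarrow>
     j \<in> carrier G \<rightarrow> alg_center A \<inter> Units A \<and>
     (\<forall>\<gamma>\<in>carrier G. \<forall>\<mu>\<in>carrier G. j (\<gamma> \<otimes>\<^bsub>G\<^esub> \<mu>) = act (j \<gamma>) \<mu> \<otimes>\<^bsub>A\<^esub> j \<mu>)"

definition change_of_variable ::
    "('a, 'm) ring_scheme \<Rightarrow> ('g, 'n) monoid_scheme \<Rightarrow> ('a \<Rightarrow> 'g \<Rightarrow> 'a) \<Rightarrow> ('g \<Rightarrow> 'a)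
      \<Rightarrow> ('a \<Rightarrow> complex) \<Rightarrow> bool" where
  "change_of_variable A G act j \<tau> \<longleftrightarrow>
     (\<forall>a\<in>carrier A. \<forall>\<gamma>\<in>carrier G. \<tau> (act a \<gamma> \<otimes>\<^bsub>A\<^esub> j \<gamma>) = \<tau> a)"

section \<open>The algebraic crossed product\<close>

definition supp :: "('a, 'm) ring_scheme \<Rightarrow> ('g, 'n) monoid_scheme \<Rightarrow> ('g \<Rightarrow> 'a) \<Rightarrow> 'g set" where
  "supp A G f = {\<gamma>\<in>carrier G. f \<gamma> \<noteq> \<zero>\<^bsub>A\<^esub>}"

text \<open>The elementary tensor \<open>a \<otimes> \<gamma>\<close>.\<close>

definition tensor :: "('a, 'm) ring_scheme \<Rightarrow> ('g, 'n) monoid_scheme \<Rightarrow> 'a \<Rightarrow> 'g \<Rightarrow> ('g \<Rightarrow> 'a)" where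
  "tensor A G a \<gamma> = (\<lambda>\<rho>\<in>carrier G. if \<rho> = \<gamma> then a else \<zero>\<^bsub>A\<^esub>)"

text \<open>
  The vector space \<open>A \<otimes> \<complex>\<Gamma>\<close> is realized as the space of finitely supported functions from
  \<open>\<Gamma>\<close> to \<open>A\<close>: the function \<open>f\<close> stands for the sum of the tensors \<open>f \<gamma> \<otimes> \<gamma>\<close>. The product
  is the bilinear extension of \<open>(a \<otimes> \<gamma>)(b \<otimes> \<mu>) = (a \<cdot> \<mu>) b \<otimes> \<gamma>\<mu>\<close>: the coefficient of a
  product \<open>f g\<close> at \<open>\<rho>\<close> collects the pairs \<open>(\<gamma>, \<mu>)\<close> with \<open>\<gamma>\<mu> = \<rho>\<close>, that is,
  \<open>\<mu> = \<gamma>\<^sup>-\<^sup>1 \<rho>\<close>; see \<open>tensor_mult_tensor\<close> below.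
\<close>

definition crossed_product ::
    "(complex, 'a, 'm) module_scheme \<Rightarrow> ('g, 'n) monoid_scheme \<Rightarrow> ('a \<Rightarrow> 'g \<Rightarrow> 'a)
      \<Rightarrow> (complex, 'g \<Rightarrow> 'a) module" where
  "crossed_product A G act =
    \<lparr>carrier = {f \<in> carrier G \<rightarrow>\<^sub>E carrier A. finite (supp A G f)},
     monoid.mult = (\<lambda>f g. \<lambda>\<rho>\<in>carrier G.
       \<Oplus>\<^bsub>A\<^esub>\<gamma>\<in>supp A G f. act (f \<gamma>) (inv\<^bsub>G\<^esub> \<gamma> \<otimes>\<^bsub>G\<^esub> \<rho>) \<otimes>\<^bsub>A\<^esub> g (inv\<^bsub>G\<^esub> \<gamma> \<otimes>\<^bsub>G\<^esub> \<rho>)),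
     one = tensor A G \<one>\<^bsub>A\<^esub> \<one>\<^bsub>G\<^esub>,
     zero = (\<lambda>\<rho>\<in>carrier G. \<zero>\<^bsub>A\<^esub>),
     add = (\<lambda>f g. \<lambda>\<rho>\<in>carrier G. f \<rho> \<oplus>\<^bsub>A\<^esub> g \<rho>),
     smult = (\<lambda>c f. \<lambda>\<rho>\<in>carrier G. c \<odot>\<^bsub>A\<^esub> f \<rho>)\<rparr>"

text \<open>
  The linear extension of \<open>a \<otimes> \<gamma> \<mapsto> F a \<gamma>\<close> to a map from the crossed product to \<open>M\<close>; it is
  meant for \<open>F\<close> that are linear in the first argument.
\<close>

definition lin_ext ::
    "('a, 'm) ring_scheme \<Rightarrow> ('g, 'n) monoid_scheme \<Rightarrow> ('b, 'k) ring_scheme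
      \<Rightarrow> ('a \<Rightarrow> 'g \<Rightarrow> 'b) \<Rightarrow> ('g \<Rightarrow> 'a) \<Rightarrow> 'b" where
  "lin_ext A G M F f = (\<Oplus>\<^bsub>M\<^esub>\<gamma>\<in>supp A G f. F (f \<gamma>) \<gamma>)"

definition cp_sigma ::
    "(complex, 'a, 'm) module_scheme \<Rightarrow> ('g, 'n) monoid_scheme \<Rightarrow> ('a \<Rightarrow> 'g \<Rightarrow> 'a)
      \<Rightarrow> ('g \<Rightarrow> 'a) \<Rightarrow> ('g \<Rightarrow> 'a) \<Rightarrow> ('g \<Rightarrow> 'a)" where
  "cp_sigma A G act j = lin_ext A G (crossed_product A G act)
     (\<lambda>a \<gamma>. tensor A G (act (j (inv\<^bsub>G\<^esub> \<gamma>)) \<gamma> \<otimes>\<^bsub>A\<^esub> a) \<gamma>)"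

definition cp_delta ::
    "(complex, 'a, 'm) module_scheme \<Rightarrow> ('g, 'n) monoid_scheme \<Rightarrow> ('a \<Rightarrow> 'g \<Rightarrow> 'a)
      \<Rightarrow> ('g \<Rightarrow> 'a) \<Rightarrow> ('a \<Rightarrow> 'a) \<Rightarrow> nat \<Rightarrow> ('g \<Rightarrow> 'a) \<Rightarrow> ('g \<Rightarrow> 'a)" where
  "cp_delta A G act j \<delta> s = lin_ext A G (crossed_product A G act)
     (\<lambda>a \<gamma>.
        tensor A G
          (\<delta> (act a (inv\<^bsub>G\<^esub> \<gamma>) \<otimes>\<^bsub>A\<^esub> j (inv\<^bsub>G\<^esub> \<gamma>) [^]\<^bsub>A\<^esub> s) \<otimes>\<^bsub>A\<^esub> inv\<^bsub>A\<^esub> (j (inv\<^bsub>G\<^esub> \<gamma>) [^]\<^bsub>A\<^esub> s))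
          \<one>\<^bsub>G\<^esub>
        \<otimes>\<^bsub>crossed_product A G act\<^esub> tensor A G \<one>\<^bsub>A\<^esub> \<gamma>)"

definition cp_functional ::
    "('a, 'm) ring_scheme \<Rightarrow> ('g, 'n) monoid_scheme \<Rightarrow> ('a \<Rightarrow> complex) \<Rightarrow> ('g \<Rightarrow> 'a) \<Rightarrow> complex" where
  "cp_functional A G \<tau> = lin_ext A G complexes (\<lambda>a \<gamma>. if \<gamma> = \<one>\<^bsub>G\<^esub> then \<tau> a else 0)"

section \<open>Compatibility with elementary tensors\<close>

lemma supp_tensor:
  "\<gamma> \<in> carrier G \<Longrightarrow> supp A G (tensor A G a \<gamma>) = (if a = \<zero>\<^bsub>A\<^esub> then {} else {\<gamma>})"
  by (auto simp: supp_def tensor_def)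

lemma lin_ext_tensor:
  assumes "abelian_monoid M" "\<gamma> \<in> carrier G" "F a \<gamma> \<in> carrier M" "F \<zero>\<^bsub>A\<^esub> \<gamma> = \<zero>\<^bsub>M\<^esub>"
  shows "lin_ext A G M F (tensor A G a \<gamma>) = F a \<gamma>"
proof -
  interpret abelian_monoid M by fact
  have "tensor A G a \<gamma> \<gamma> = a"
    using assms(2) by (simp add: tensor_def)
  then show ?thesis
    using assms(2-4) by (simp add: lin_ext_def supp_tensor)
qed

lemma tensor_mult_tensor:
  assumes "complex_algebra A" "group G" "right_action A G act"
    and "a \<in> carrier A" "b \<in> carrier A" "\<gamma> \<in> carrier G" "\<mu> \<in> carrier G"
  shows "tensor A G a \<gamma> \<otimes>\<^bsub>crossed_product A G act\<^esub> tensor A G b \<mu>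
         = tensor A G (act a \<mu> \<otimes>\<^bsub>A\<^esub> b) (\<gamma> \<otimes>\<^bsub>G\<^esub> \<mu>)"
proof -
  interpret A: complex_algebra A by fact
  interpret G: group G by fact
  have hom: "(\<lambda>a. act a \<rho>) \<in> ring_hom A A" if "\<rho> \<in> carrier G" for \<rho>
    using assms(3) that by (auto simp: right_action_def algebra_automorphism_def ring_iso_def)
  have cl: "act x \<rho> \<in> carrier A" if "x \<in> carrier A" "\<rho> \<in> carrier G" for x \<rho>
    using ring_hom_closed[OF hom] that by blast
  have z: "act \<zero>\<^bsub>A\<^esub> \<rho> = \<zero>\<^bsub>A\<^esub>" if "\<rho> \<in> carrier G" for \<rho>
    using ring_hom_zero[OF hom[OF that] A.ring_axioms A.ring_axioms] .
  have eq: "inv\<^bsub>G\<^esub> \<gamma> \<otimes>\<^bsub>G\<^esub> \<rho> = \<mu> \<longleftrightarrow> \<rho> = \<gamma> \<otimes>\<^bsub>G\<^esub> \<mu>" if "\<rho> \<in> carrier G" for \<rho>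
    using assms that by (metis G.inv_closed G.inv_solve_left G.inv_inv)
  let ?B = "crossed_product A G act"
  have val: "(tensor A G a \<gamma> \<otimes>\<^bsub>?B\<^esub> tensor A G b \<mu>) \<rho>
      = (if \<rho> = \<gamma> \<otimes>\<^bsub>G\<^esub> \<mu> then act a \<mu> \<otimes>\<^bsub>A\<^esub> b else \<zero>\<^bsub>A\<^esub>)" if \<rho>: "\<rho> \<in> carrier G" for \<rho>
  proof -
    have a: "tensor A G a \<gamma> \<gamma> = a"
      using assms by (simp add: tensor_def)
    have b: "tensor A G b \<mu> (inv\<^bsub>G\<^esub> \<gamma> \<otimes>\<^bsub>G\<^esub> \<rho>) = (if \<rho> = \<gamma> \<otimes>\<^bsub>G\<^esub> \<mu> then b else \<zero>\<^bsub>A\<^esub>)"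
      using assms \<rho> eq[OF \<rho>] by (simp add: tensor_def)
    have "(tensor A G a \<gamma> \<otimes>\<^bsub>?B\<^esub> tensor A G b \<mu>) \<rho>
        = act a (inv\<^bsub>G\<^esub> \<gamma> \<otimes>\<^bsub>G\<^esub> \<rho>) \<otimes>\<^bsub>A\<^esub> (if \<rho> = \<gamma> \<otimes>\<^bsub>G\<^esub> \<mu> then b else \<zero>\<^bsub>A\<^esub>)"
    proof -
      define t where "t = (\<lambda>\<gamma>'. act (tensor A G a \<gamma> \<gamma>') (inv\<^bsub>G\<^esub> \<gamma>' \<otimes>\<^bsub>G\<^esub> \<rho>)
        \<otimes>\<^bsub>A\<^esub> tensor A G b \<mu> (inv\<^bsub>G\<^esub> \<gamma>' \<otimes>\<^bsub>G\<^esub> \<rho>))"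
      have t: "t \<gamma> = act a (inv\<^bsub>G\<^esub> \<gamma> \<otimes>\<^bsub>G\<^esub> \<rho>) \<otimes>\<^bsub>A\<^esub> (if \<rho> = \<gamma> \<otimes>\<^bsub>G\<^esub> \<mu> then b else \<zero>\<^bsub>A\<^esub>)"
        by (simp add: t_def a b)
      moreover have "t \<gamma> \<in> carrier A" "a = \<zero>\<^bsub>A\<^esub> \<Longrightarrow> t \<gamma> = \<zero>\<^bsub>A\<^esub>"
        using assms \<rho> cl z by (auto simp: t)
      moreover have "(tensor A G a \<gamma> \<otimes>\<^bsub>?B\<^esub> tensor A G b \<mu>) \<rho>
          = (\<Oplus>\<^bsub>A\<^esub>\<gamma>'\<in>supp A G (tensor A G a \<gamma>). t \<gamma>')"
        using \<rho> by (simp add: crossed_product_def t_def)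
      ultimately show ?thesis
        using assms(6) by (cases "a = \<zero>\<^bsub>A\<^esub>") (simp_all add: supp_tensor)
    qed
    then show ?thesis
      using assms \<rho> cl eq[OF \<rho>] by auto
  qed
  have ext: "tensor A G a \<gamma> \<otimes>\<^bsub>?B\<^esub> tensor A G b \<mu> \<in> extensional (carrier G)"
    by (simp add: crossed_product_def)
  have val': "tensor A G (act a \<mu> \<otimes>\<^bsub>A\<^esub> b) (\<gamma> \<otimes>\<^bsub>G\<^esub> \<mu>) \<rho>
      = (if \<rho> = \<gamma> \<otimes>\<^bsub>G\<^esub> \<mu> then act a \<mu> \<otimes>\<^bsub>A\<^esub> b else \<zero>\<^bsub>A\<^esub>)" if "\<rho> \<in> carrier G" for \<rho>
    using that by (simp add: tensor_def)
  have ext': "tensor A G (act a \<mu> \<otimes>\<^bsub>A\<^esub> b) (\<gamma> \<otimes>\<^bsub>G\<^esub> \<mu>) \<in> extensional (carrier G)"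
    by (simp add: tensor_def)
  show ?thesis
    by (rule extensionalityI[OF ext ext']) (simp add: val val')
qed

end

theory Submission
  imports Defs
begin

text \<open>
  The cocycle identity gives \<open>(j \<gamma>\<^sup>-\<^sup>1) \<cdot> \<gamma> = (j \<gamma>)\<^sup>-\<^sup>1\<close>, so \<open>\<sigma>\<close> multiplies the coefficient at \<open>\<gamma>\<close> by
  the central unit \<open>(j \<gamma>)\<^sup>-\<^sup>1\<close>. Likewise the twisting hypothesis on \<open>\<delta>\<close> turns \<open>\<delta>'\<^sub>s\<close> into the
  coefficientwise map \<open>a \<mapsto> \<delta>(a P\<^sub>\<gamma>) Q\<^sub>\<gamma>\<close> with \<open>P\<^sub>\<gamma> = (j \<gamma>)\<^sup>-\<^sup>s\<close> and \<open>Q\<^sub>\<gamma> = (j \<gamma>)\<^sup>-\<^sup>1 (j \<gamma>)\<^sup>s\<close>. Both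
  \<open>P\<close> and \<open>Q\<close> are again cocycles and \<open>P\<^sub>\<gamma> Q\<^sub>\<gamma> = (j \<gamma>)\<^sup>-\<^sup>1\<close>, so the Leibniz rule for \<open>\<delta>\<close> becomes the
  \<open>\<sigma>\<close>-twisted one. For the traces only the coefficient at \<open>1\<close> matters: \<open>\<delta>'\<^sub>s\<close> acts on it as \<open>\<delta>\<close>,
  and the \<open>\<sigma>\<close>-trace identity is the change of variable by \<open>\<gamma>\<^sup>-\<^sup>1\<close> followed by the trace property.
\<close>

section \<open>Additive and linear maps\<close>

text \<open>Abelian monoids are enough for finite sums, and this is the structure established for
  the crossed product; without cancellation, preservation of zero has to be assumed. It serves for
  evaluation of a crossed product element at a group element, for linear self-maps of
  \<open>A\<close> and for traces.\<close>

lemma additive_finsum: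
  assumes "abelian_monoid M" "abelian_monoid N"
    and h: "h \<in> carrier M \<rightarrow> carrier N" "h \<zero>\<^bsub>M\<^esub> = \<zero>\<^bsub>N\<^esub>"
      "\<And>x y. \<lbrakk>x \<in> carrier M; y \<in> carrier M\<rbrakk> \<Longrightarrow> h (x \<oplus>\<^bsub>M\<^esub> y) = h x \<oplus>\<^bsub>N\<^esub> h y"
    and "finite S" "f \<in> S \<rightarrow> carrier M"
  shows "h (finsum M f S) = finsum N (\<lambda>i. h (f i)) S"
proof -
  interpret M: abelian_monoid M by fact
  interpret N: abelian_monoid N by fact
  show ?thesis
    using assms(6,7)
  proof (induction S rule: finite_induct)
    case empty
    then show ?case by (simp add: h)
  next
    case (insert i S)
    then have "f i \<in> carrier M" "f \<in> S \<rightarrow> carrier M" "(\<lambda>i. h (f i)) \<in> S \<rightarrow> carrier N"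
      "h (f i) \<in> carrier N"
      using h(1) by auto
    with insert show ?case by (simp add: h(3))
  qed
qed

lemma complexes_simps [simp]:
  "carrier complexes = UNIV" "\<zero>\<^bsub>complexes\<^esub> = 0"
  "x \<oplus>\<^bsub>complexes\<^esub> y = x + y" "c \<odot>\<^bsub>complexes\<^esub> x = c * x"
  by (simp_all add: complexes_def)

lemma
  assumes "linear_map V W f"
  shows linear_map_closed: "x \<in> carrier V \<Longrightarrow> f x \<in> carrier W"
    and linear_map_add: "\<lbrakk>x \<in> carrier V; y \<in> carrier V\<rbrakk> \<Longrightarrow> f (x \<oplus>\<^bsub>V\<^esub> y) = f x \<oplus>\<^bsub>W\<^esub> f y"
    and linear_map_smult: "x \<in> carrier V \<Longrightarrow> f (c \<odot>\<^bsub>V\<^esub> x) = c \<odot>\<^bsub>W\<^esub> f x"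
  using assms by (auto simp: linear_map_def)

lemma linear_map_zero:
  assumes "abelian_group V" "abelian_group W" "linear_map V W f"
  shows "f \<zero>\<^bsub>V\<^esub> = \<zero>\<^bsub>W\<^esub>"
proof -
  interpret V: abelian_group V by fact
  interpret W: abelian_group W by fact
  have "f \<zero>\<^bsub>V\<^esub> \<oplus>\<^bsub>W\<^esub> f \<zero>\<^bsub>V\<^esub> = f \<zero>\<^bsub>V\<^esub>"
    using linear_map_add[OF assms(3) V.zero_closed V.zero_closed] by simp
  then show ?thesis
    using linear_map_closed[OF assms(3) V.zero_closed] W.add.l_cancel_one by simp
qed

section \<open>The action and the center\<close>

locale algebra_action = complex_algebra A + G: group G
  for A :: "(complex, 'a, 'm) module_scheme" (structure)
    and G :: "('g, 'n) monoid_scheme" and act :: "'a \<Rightarrow> 'g \<Rightarrow> 'a" +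
  assumes action: "right_action A G act"
begin

abbreviation "B \<equiv> crossed_product A G act"

lemma act_ring_hom: "\<gamma> \<in> carrier G \<Longrightarrow> (\<lambda>a. act a \<gamma>) \<in> ring_hom A A"
  using action by (auto simp: right_action_def algebra_automorphism_def ring_iso_def)

lemma act_closed [simp]: "\<lbrakk>a \<in> carrier A; \<gamma> \<in> carrier G\<rbrakk> \<Longrightarrow> act a \<gamma> \<in> carrier A"
  using ring_hom_closed[OF act_ring_hom] by blast

lemma act_mult:
  "\<lbrakk>a \<in> carrier A; b \<in> carrier A; \<gamma> \<in> carrier G\<rbrakk> \<Longrightarrow> act (a \<otimes> b) \<gamma> = act a \<gamma> \<otimes> act b \<gamma>"
  using ring_hom_mult[OF act_ring_hom] by blast

lemma act_one [simp]: "\<gamma> \<in> carrier G \<Longrightarrow> act \<one> \<gamma> = \<one>"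
  using ring_hom_one[OF act_ring_hom] by blast

lemma act_zero [simp]: "\<gamma> \<in> carrier G \<Longrightarrow> act \<zero> \<gamma> = \<zero>"
  using ring_hom_zero[OF act_ring_hom ring_axioms ring_axioms] by blast

lemma act_id [simp]: "a \<in> carrier A \<Longrightarrow> act a \<one>\<^bsub>G\<^esub> = a"
  using action by (auto simp: right_action_def)

lemma act_act:
  "\<lbrakk>a \<in> carrier A; \<gamma> \<in> carrier G; \<mu> \<in> carrier G\<rbrakk> \<Longrightarrow> act (act a \<gamma>) \<mu> = act a (\<gamma> \<otimes>\<^bsub>G\<^esub> \<mu>)"
  using action by (auto simp: right_action_def)

lemma center_closed: "z \<in> alg_center A \<Longrightarrow> z \<in> carrier A"
  by (simp add: alg_center_def)

lemma center_comm: "\<lbrakk>z \<in> alg_center A; a \<in> carrier A\<rbrakk> \<Longrightarrow> a \<otimes> z = z \<otimes> a"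
  by (simp add: alg_center_def)

text \<open>Stands in for left-commutativity: products in \<open>A\<close> can be reordered only
  around a central factor.\<close>

lemma center_lcomm:
  "\<lbrakk>z \<in> alg_center A; a \<in> carrier A; b \<in> carrier A\<rbrakk> \<Longrightarrow> a \<otimes> (z \<otimes> b) = z \<otimes> (a \<otimes> b)"
  by (metis center_closed center_comm m_assoc)

lemma center_mult:
  assumes "z \<in> alg_center A" "w \<in> alg_center A"
  shows "z \<otimes> w \<in> alg_center A"
  unfolding alg_center_def
proof (intro CollectI conjI ballI)
  have cl: "z \<in> carrier A" "w \<in> carrier A"
    using assms by (auto intro: center_closed)
  then show "z \<otimes> w \<in> carrier A"
    by simp
  fix a assume a: "a \<in> carrier A"
  have "z \<otimes> w \<otimes> a = z \<otimes> (a \<otimes> w)"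
    using a cl center_comm[OF assms(2) a] by (simp add: m_assoc)
  also have "\<dots> = a \<otimes> (z \<otimes> w)"
    using center_lcomm[OF assms(1) a cl(2)] by simp
  finally show "z \<otimes> w \<otimes> a = a \<otimes> (z \<otimes> w)" .
qed

text \<open>Pad \<open>a\<close> on the right to \<open>a \<otimes> z \<otimes> inv z\<close>; the
  central \<open>z\<close> then moves left and cancels against the leading
  \<open>inv z\<close>.\<close>

lemma center_inv:
  assumes "z \<in> alg_center A" and z: "z \<in> Units A"
  shows "inv z \<in> alg_center A"
  unfolding alg_center_def
proof (intro CollectI conjI ballI)
  fix a assume a: "a \<in> carrier A"
  have cl: "z \<in> carrier A" "inv z \<in> carrier A"
    using z by auto
  have "inv z \<otimes> a = inv z \<otimes> (a \<otimes> z) \<otimes> inv z"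
    using a cl z by (simp add: m_assoc)
  also have "\<dots> = a \<otimes> inv z"
    using a cl z assms(1) by (simp add: center_comm flip: m_assoc)
  finally show "inv z \<otimes> a = a \<otimes> inv z" .
qed (use z in simp)

text \<open>Since \<gamma> acts surjectively, every \<open>a\<close> is the image of some
  \<open>?b\<close>, and the commutation of \<open>z\<close> with \<open>?b\<close> is transported
  by the action.\<close>

lemma act_center:
  assumes z: "z \<in> alg_center A" and \<gamma>: "\<gamma> \<in> carrier G"
  shows "act z \<gamma> \<in> alg_center A"
  unfolding alg_center_def
proof (intro CollectI conjI ballI)
  show "act z \<gamma> \<in> carrier A"
    using center_closed[OF z] \<gamma> by simp
  fix a assume a: "a \<in> carrier A"
  let ?b = "act a (inv\<^bsub>G\<^esub> \<gamma>)"
  have "act ?b \<gamma> = a" "?b \<in> carrier A"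
    using a \<gamma> by (simp_all add: act_act)
  then show "act z \<gamma> \<otimes> a = a \<otimes> act z \<gamma>"
    using act_mult[OF center_closed[OF z] _ \<gamma>, of ?b] act_mult[OF _ center_closed[OF z] \<gamma>, of ?b]
      center_comm[OF z, of ?b] by simp
qed

lemma unit_inverses_unique:
  "\<lbrakk>x \<in> carrier A; y \<in> carrier A; z \<in> carrier A; x \<otimes> z = \<one>; z \<otimes> y = \<one>\<rbrakk> \<Longrightarrow> x = y"
  by (metis l_one m_assoc r_one)

section \<open>One-cocycles and their closure under inverses, products and powers\<close>

context
  fixes p assumes p: "one_cocycle A G act p"
begin

lemma cocycle_center: "\<gamma> \<in> carrier G \<Longrightarrow> p \<gamma> \<in> alg_center A"
  using p by (auto simp: one_cocycle_def)

lemma cocycle_unit: "\<gamma> \<in> carrier G \<Longrightarrow> p \<gamma> \<in> Units A"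
  using p by (auto simp: one_cocycle_def)

lemma cocycle_closed: "\<gamma> \<in> carrier G \<Longrightarrow> p \<gamma> \<in> carrier A"
  using cocycle_unit by auto

lemma cocycle_mult_eq:
  "\<lbrakk>\<gamma> \<in> carrier G; \<mu> \<in> carrier G\<rbrakk> \<Longrightarrow> p (\<gamma> \<otimes>\<^bsub>G\<^esub> \<mu>) = act (p \<gamma>) \<mu> \<otimes> p \<mu>"
  using p by (auto simp: one_cocycle_def)

text \<open>The cocycle identity at the pair (1, 1) makes this value idempotent, and an idempotent
  unit is 1.\<close>

lemma cocycle_one: "p \<one>\<^bsub>G\<^esub> = \<one>"
proof -
  have "p \<one>\<^bsub>G\<^esub> \<otimes> p \<one>\<^bsub>G\<^esub> = p \<one>\<^bsub>G\<^esub> \<otimes> \<one>"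
    using cocycle_mult_eq[of "\<one>\<^bsub>G\<^esub>" "\<one>\<^bsub>G\<^esub>"] cocycle_closed by simp
  then show ?thesis
    by (metis G.one_closed Units_l_cancel cocycle_closed cocycle_unit one_closed)
qed

text \<open>The cocycle identity at the pair of the inverse of \<gamma> and \<gamma> shows a left
  inverse of \<open>p \<gamma>\<close>. With \<open>p = j\<close> this simplifies the coefficient in
  \<open>cp_sigma\<close>; with powers of \<open>j\<close> and their inverses it does so for
  \<open>cp_delta\<close>.\<close>

lemma act_cocycle_inv:
  assumes "\<gamma> \<in> carrier G"
  shows "act (p (inv\<^bsub>G\<^esub> \<gamma>)) \<gamma> = inv (p \<gamma>)"
proof (rule unit_inverses_unique)
  show "act (p (inv\<^bsub>G\<^esub> \<gamma>)) \<gamma> \<otimes> p \<gamma> = \<one>"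
    using cocycle_mult_eq[of "inv\<^bsub>G\<^esub> \<gamma>" \<gamma>] cocycle_one assms by simp
qed (use assms cocycle_closed cocycle_unit in simp_all)

text \<open>Moving the central \<open>p \<mu>\<close> past \<open>?b\<close> shows that the proposed
  value is a right inverse of the unit \<open>p (\<gamma> \<otimes> \<mu>)\<close>, hence its
  inverse.\<close>

lemma one_cocycle_inv: "one_cocycle A G act (\<lambda>\<gamma>. inv (p \<gamma>))"
  unfolding one_cocycle_def
proof (intro conjI ballI funcsetI IntI)
  fix \<gamma> assume \<gamma>: "\<gamma> \<in> carrier G"
  show "inv (p \<gamma>) \<in> alg_center A" "inv (p \<gamma>) \<in> Units A"
    using \<gamma> cocycle_center cocycle_unit center_inv by auto
  fix \<mu> assume \<mu>: "\<mu> \<in> carrier G"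
  let ?a = "act (p \<gamma>) \<mu>" and ?b = "act (inv (p \<gamma>)) \<mu>"
  have cl: "?a \<in> carrier A" "?b \<in> carrier A" "p \<mu> \<in> carrier A" "inv (p \<mu>) \<in> carrier A"
    using \<gamma> \<mu> cocycle_unit cocycle_closed by auto
  have ba: "?a \<otimes> ?b = \<one>"
    using \<gamma> \<mu> cocycle_unit[OF \<gamma>] by (simp add: Units_closed flip: act_mult)
  have "(?a \<otimes> p \<mu>) \<otimes> (?b \<otimes> inv (p \<mu>)) = (?a \<otimes> ?b) \<otimes> (p \<mu> \<otimes> inv (p \<mu>))"
    using cl cocycle_center[OF \<mu>] by (simp add: m_assoc center_lcomm)
  also have "\<dots> = \<one>"
    using ba cocycle_unit[OF \<mu>] by simp
  finally have "p (\<gamma> \<otimes>\<^bsub>G\<^esub> \<mu>) \<otimes> (?b \<otimes> inv (p \<mu>)) = \<one>"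
    using \<gamma> \<mu> by (simp add: cocycle_mult_eq)
  then show "inv (p (\<gamma> \<otimes>\<^bsub>G\<^esub> \<mu>)) = ?b \<otimes> inv (p \<mu>)"
    using \<gamma> \<mu> cl cocycle_unit[of "\<gamma> \<otimes>\<^bsub>G\<^esub> \<mu>"] cocycle_closed[of "\<gamma> \<otimes>\<^bsub>G\<^esub> \<mu>"]
    by - (rule unit_inverses_unique[where z = "p (\<gamma> \<otimes>\<^bsub>G\<^esub> \<mu>)"], simp_all)
qed

text \<open>The two cocycle identities multiply together because \<open>p \<mu>\<close> is central
  and can pass the factor coming from \<open>q \<gamma>\<close>.\<close>

lemma one_cocycle_mult:
  assumes q: "one_cocycle A G act q"
  shows "one_cocycle A G act (\<lambda>\<gamma>. p \<gamma> \<otimes> q \<gamma>)"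
  unfolding one_cocycle_def
proof (intro conjI ballI funcsetI IntI)
  fix \<gamma> assume \<gamma>: "\<gamma> \<in> carrier G"
  have "q \<gamma> \<in> alg_center A" "q \<gamma> \<in> Units A"
    using \<gamma> q by (auto simp: one_cocycle_def)
  then show "p \<gamma> \<otimes> q \<gamma> \<in> alg_center A" "p \<gamma> \<otimes> q \<gamma> \<in> Units A"
    using \<gamma> cocycle_center cocycle_unit center_mult by simp_all
  fix \<mu> assume \<mu>: "\<mu> \<in> carrier G"
  have "q \<gamma> \<in> carrier A" "q \<mu> \<in> carrier A"
    and "q (\<gamma> \<otimes>\<^bsub>G\<^esub> \<mu>) = act (q \<gamma>) \<mu> \<otimes> q \<mu>"
    using q \<gamma> \<mu> by (auto simp: one_cocycle_def)
  then show "p (\<gamma> \<otimes>\<^bsub>G\<^esub> \<mu>) \<otimes> q (\<gamma> \<otimes>\<^bsub>G\<^esub> \<mu>) = act (p \<gamma> \<otimes> q \<gamma>) \<mu> \<otimes> (p \<mu> \<otimes> q \<mu>)"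
    using \<gamma> \<mu> cocycle_closed
    by (simp add: cocycle_mult_eq act_mult m_assoc center_lcomm[OF cocycle_center[OF \<mu>]])
qed

end

lemma one_cocycle_pow:
  assumes p: "one_cocycle A G act p"
  shows "one_cocycle A G act (\<lambda>\<gamma>. p \<gamma> [^] (s::nat))"
proof (induction s)
  case 0
  show ?case by (auto simp: one_cocycle_def alg_center_def)
next
  case (Suc s)
  from one_cocycle_mult[OF this p] show ?case by simp
qed

section \<open>The additive structure of the crossed product\<close>

lemma B_carrier: "f \<in> carrier B \<longleftrightarrow> f \<in> carrier G \<rightarrow>\<^sub>E carrier A \<and> finite (supp A G f)"
  by (simp add: crossed_product_def)

lemma B_apply_closed: "\<lbrakk>f \<in> carrier B; \<rho> \<in> carrier G\<rbrakk> \<Longrightarrow> f \<rho> \<in> carrier A"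
  by (auto simp: B_carrier)

lemma B_finite_supp: "f \<in> carrier B \<Longrightarrow> finite (supp A G f)"
  by (simp add: B_carrier)

lemma B_add: "f \<oplus>\<^bsub>B\<^esub> g = (\<lambda>\<rho>\<in>carrier G. f \<rho> \<oplus> g \<rho>)"
  by (simp add: crossed_product_def)

lemma B_smult: "c \<odot>\<^bsub>B\<^esub> f = (\<lambda>\<rho>\<in>carrier G. c \<odot> f \<rho>)"
  by (simp add: crossed_product_def)

lemma B_zero: "\<zero>\<^bsub>B\<^esub> = (\<lambda>\<rho>\<in>carrier G. \<zero>)"
  by (simp add: crossed_product_def)

lemma B_one: "\<one>\<^bsub>B\<^esub> = tensor A G \<one> \<one>\<^bsub>G\<^esub>"
  by (simp add: crossed_product_def)

lemma B_eqI:
  assumes "f \<in> extensional (carrier G)" "g \<in> extensional (carrier G)"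
    and "\<And>\<rho>. \<rho> \<in> carrier G \<Longrightarrow> f \<rho> = g \<rho>"
  shows "f = g"
  using assms by (rule extensionalityI)

lemma B_extensional: "f \<in> carrier B \<Longrightarrow> f \<in> extensional (carrier G)"
  by (auto simp: B_carrier PiE_def)

lemma B_mult_extensional: "f \<otimes>\<^bsub>B\<^esub> g \<in> extensional (carrier G)"
  by (simp add: crossed_product_def)

lemma B_add_closed:
  assumes "f \<in> carrier B" "g \<in> carrier B"
  shows "f \<oplus>\<^bsub>B\<^esub> g \<in> carrier B"
proof -
  have "supp A G (f \<oplus>\<^bsub>B\<^esub> g) \<subseteq> supp A G f \<union> supp A G g"
    using assms by (auto simp: supp_def B_add)
  then show ?thesis
    using assms B_apply_closed
    by (auto simp: B_carrier B_add intro: finite_subset)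
qed

text \<open>Gives access to the rules for the finite sums in \<open>B\<close> by which
  \<open>lin_ext\<close> is defined.\<close>

lemma B_abelian_monoid: "abelian_monoid B"
proof (rule abelian_monoidI)
  show "\<zero>\<^bsub>B\<^esub> \<in> carrier B"
    by (auto simp: B_carrier B_zero supp_def)
qed (auto intro!: B_add_closed B_eqI simp: B_extensional,
     auto simp: B_add B_zero B_apply_closed a_ac)

lemma tensor_closed:
  assumes "a \<in> carrier A" "\<gamma> \<in> carrier G"
  shows "tensor A G a \<gamma> \<in> carrier B"
  using assms by (auto simp: B_carrier supp_tensor) (auto simp: tensor_def)

lemma B_finsum_apply:
  assumes "finite S" "F \<in> S \<rightarrow> carrier B" "\<rho> \<in> carrier G"
  shows "finsum B F S \<rho> = (\<Oplus>i\<in>S. F i \<rho>)"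
  using assms
  by (intro additive_finsum[OF B_abelian_monoid abelian_monoid_axioms, where h = "\<lambda>f. f \<rho>"])
    (auto simp: B_apply_closed B_add B_zero)

section \<open>Maps acting coefficient by coefficient\<close>

text \<open>Replaces a linear extension by a closed formula, from which all later computations
  start. At \<rho> only the summand with \<gamma> = \<rho> survives; if \<rho> lies outside the
  support, the formula gives \<open>T \<rho> \<zero> = \<zero>\<close> as well.\<close>

lemma lin_ext_diagonal:
  assumes T: "\<And>\<gamma>. \<gamma> \<in> carrier G \<Longrightarrow> T \<gamma> \<in> carrier A \<rightarrow> carrier A" "\<And>\<gamma>. \<gamma> \<in> carrier G \<Longrightarrow> T \<gamma> \<zero> = \<zero>"
    and F: "\<And>a \<gamma>. \<lbrakk>a \<in> carrier A; \<gamma> \<in> carrier G\<rbrakk> \<Longrightarrow> F a \<gamma> = tensor A G (T \<gamma> a) \<gamma>"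
    and f: "f \<in> carrier B"
  shows "lin_ext A G B F f = (\<lambda>\<rho>\<in>carrier G. T \<rho> (f \<rho>))"
proof (rule B_eqI)
  interpret B: abelian_monoid B by (rule B_abelian_monoid)
  have S: "supp A G f \<subseteq> carrier G"
    by (auto simp: supp_def)
  have F_eq: "F (f \<gamma>) \<gamma> = tensor A G (T \<gamma> (f \<gamma>)) \<gamma>" "T \<gamma> (f \<gamma>) \<in> carrier A"
    if "\<gamma> \<in> carrier G" for \<gamma>
    using that F T(1) B_apply_closed[OF f that] by auto
  have F_cl: "(\<lambda>\<gamma>. F (f \<gamma>) \<gamma>) \<in> supp A G f \<rightarrow> carrier B"
    using S F_eq tensor_closed by auto
  show "lin_ext A G B F f \<in> extensional (carrier G)"
    unfolding lin_ext_def by (intro B_extensional B.finsum_closed F_cl)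
  fix \<rho> assume \<rho>: "\<rho> \<in> carrier G"
  have "lin_ext A G B F f \<rho> = (\<Oplus>\<gamma>\<in>supp A G f. F (f \<gamma>) \<gamma> \<rho>)"
    unfolding lin_ext_def by (rule B_finsum_apply[OF B_finite_supp[OF f] F_cl \<rho>])
  also have "\<dots> = (\<Oplus>\<gamma>\<in>supp A G f. if \<rho> = \<gamma> then T \<gamma> (f \<gamma>) else \<zero>)"
    using S F_eq \<rho> by (intro finsum_cong') (auto simp: tensor_def subset_iff)
  also have "\<dots> = T \<rho> (f \<rho>)"
  proof (cases "\<rho> \<in> supp A G f")
    case True
    then show ?thesis
      using S F_eq B_finite_supp[OF f] by (intro finsum_singleton) (auto simp: subset_iff)
  next
    case False
    then have "T \<rho> (f \<rho>) = \<zero>"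
      using \<rho> T(2) by (simp add: supp_def)
    moreover have "(\<Oplus>\<gamma>\<in>supp A G f. if \<rho> = \<gamma> then T \<gamma> (f \<gamma>) else \<zero>) = (\<Oplus>\<gamma>\<in>supp A G f. \<zero>)"
      using False by (intro finsum_cong') auto
    ultimately show ?thesis by simp
  qed
  finally show "lin_ext A G B F f \<rho> = (\<lambda>\<rho>\<in>carrier G. T \<rho> (f \<rho>)) \<rho>"
    using \<rho> by simp
qed simp

text \<open>As each \<open>T \<gamma>\<close> fixes zero, the support cannot grow.\<close>

lemma diagonal_closed:
  assumes "\<And>\<gamma>. \<gamma> \<in> carrier G \<Longrightarrow> T \<gamma> \<in> carrier A \<rightarrow> carrier A" "\<And>\<gamma>. \<gamma> \<in> carrier G \<Longrightarrow> T \<gamma> \<zero> = \<zero>"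
    and f: "f \<in> carrier B"
  shows "(\<lambda>\<rho>\<in>carrier G. T \<rho> (f \<rho>)) \<in> carrier B"
proof -
  have "supp A G (\<lambda>\<rho>\<in>carrier G. T \<rho> (f \<rho>)) \<subseteq> supp A G f"
    using assms(2) by (auto simp: supp_def)
  then show ?thesis
    using assms(1) B_apply_closed[OF f] B_finite_supp[OF f]
    by (auto simp: B_carrier intro: finite_subset)
qed

lemma diagonal_linear:
  assumes "\<And>\<gamma>. \<gamma> \<in> carrier G \<Longrightarrow> linear_map A A (T \<gamma>)"
  shows "linear_map B B (\<lambda>f. \<lambda>\<rho>\<in>carrier G. T \<rho> (f \<rho>))"
proof -
  have "T \<gamma> \<in> carrier A \<rightarrow> carrier A" "T \<gamma> \<zero> = \<zero>" if "\<gamma> \<in> carrier G" for \<gamma>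
    using assms[OF that] linear_map_zero[OF abelian_group_axioms abelian_group_axioms]
    by (auto simp: linear_map_def)
  note closed = diagonal_closed[of T, OF this]
  show ?thesis
    unfolding linear_map_def
  proof (intro conjI ballI allI funcsetI)
    fix f g c assume f: "f \<in> carrier B" and g: "g \<in> carrier B"
    show "(\<lambda>\<rho>\<in>carrier G. T \<rho> ((f \<oplus>\<^bsub>B\<^esub> g) \<rho>))
        = (\<lambda>\<rho>\<in>carrier G. T \<rho> (f \<rho>)) \<oplus>\<^bsub>B\<^esub> (\<lambda>\<rho>\<in>carrier G. T \<rho> (g \<rho>))"
      using f g assms by (auto simp: B_add B_apply_closed linear_map_add intro!: restrict_ext)
  next
    fix f c assume f: "f \<in> carrier B"
    show "(\<lambda>\<rho>\<in>carrier G. T \<rho> ((c \<odot>\<^bsub>B\<^esub> f) \<rho>)) = c \<odot>\<^bsub>B\<^esub> (\<lambda>\<rho>\<in>carrier G. T \<rho> (f \<rho>))"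
      using f assms by (auto simp: B_smult B_apply_closed linear_map_smult intro!: restrict_ext)
  qed (use closed in auto)
qed

section \<open>Coefficients of products\<close>

text \<open>The freedom in \<open>S\<close> allows products with different left factors to be summed
  over one index set: outside the support of \<open>f\<close> the summands vanish.\<close>

lemma B_mult_apply:
  assumes f: "f \<in> carrier B" and g: "g \<in> carrier B" and \<rho>: "\<rho> \<in> carrier G"
    and S: "finite S" "supp A G f \<subseteq> S" "S \<subseteq> carrier G"
  shows "(f \<otimes>\<^bsub>B\<^esub> g) \<rho>
    = (\<Oplus>\<gamma>\<in>S. act (f \<gamma>) (inv\<^bsub>G\<^esub> \<gamma> \<otimes>\<^bsub>G\<^esub> \<rho>) \<otimes> g (inv\<^bsub>G\<^esub> \<gamma> \<otimes>\<^bsub>G\<^esub> \<rho>))"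
proof -
  have "(f \<otimes>\<^bsub>B\<^esub> g) \<rho>
    = (\<Oplus>\<gamma>\<in>supp A G f. act (f \<gamma>) (inv\<^bsub>G\<^esub> \<gamma> \<otimes>\<^bsub>G\<^esub> \<rho>) \<otimes> g (inv\<^bsub>G\<^esub> \<gamma> \<otimes>\<^bsub>G\<^esub> \<rho>))"
    using \<rho> by (simp add: crossed_product_def)
  also have "\<dots> = (\<Oplus>\<gamma>\<in>S. act (f \<gamma>) (inv\<^bsub>G\<^esub> \<gamma> \<otimes>\<^bsub>G\<^esub> \<rho>) \<otimes> g (inv\<^bsub>G\<^esub> \<gamma> \<otimes>\<^bsub>G\<^esub> \<rho>))"
  proof (rule add.finprod_mono_neutral_cong_left[OF S(1,2)])
    fix \<gamma> assume "\<gamma> \<in> S - supp A G f"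
    then have "f \<gamma> = \<zero>" "\<gamma> \<in> carrier G"
      using S(3) by (auto simp: supp_def)
    then show "act (f \<gamma>) (inv\<^bsub>G\<^esub> \<gamma> \<otimes>\<^bsub>G\<^esub> \<rho>) \<otimes> g (inv\<^bsub>G\<^esub> \<gamma> \<otimes>\<^bsub>G\<^esub> \<rho>) = \<zero>"
      using \<rho> g by (simp add: B_apply_closed)
  qed (use S(3) \<rho> f g B_apply_closed in \<open>auto simp: subset_iff\<close>)
  finally show ?thesis .
qed

text \<open>The support of a product lies in the set of products of the two supports, which is
  finite.\<close>

lemma B_mult_closed:
  assumes f: "f \<in> carrier B" and g: "g \<in> carrier B"
  shows "f \<otimes>\<^bsub>B\<^esub> g \<in> carrier B"
proof -
  let ?S = "supp A G f"
  have S: "?S \<subseteq> carrier G"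
    by (auto simp: supp_def)
  have "supp A G (f \<otimes>\<^bsub>B\<^esub> g) \<subseteq> (\<lambda>(\<gamma>, \<mu>). \<gamma> \<otimes>\<^bsub>G\<^esub> \<mu>) ` (?S \<times> supp A G g)"
  proof
    fix \<rho> assume "\<rho> \<in> supp A G (f \<otimes>\<^bsub>B\<^esub> g)"
    then have \<rho>: "\<rho> \<in> carrier G" and nz: "(f \<otimes>\<^bsub>B\<^esub> g) \<rho> \<noteq> \<zero>"
      by (simp_all add: supp_def)
    \<comment> \<open>A sum whose terms are all zero is zero, so a nonzero coefficient has a nonzero
      summand.\<close>
    obtain \<gamma> where \<gamma>: "\<gamma> \<in> ?S" "act (f \<gamma>) (inv\<^bsub>G\<^esub> \<gamma> \<otimes>\<^bsub>G\<^esub> \<rho>) \<otimes> g (inv\<^bsub>G\<^esub> \<gamma> \<otimes>\<^bsub>G\<^esub> \<rho>) \<noteq> \<zero>"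
      using nz unfolding B_mult_apply[OF f g \<rho> B_finite_supp[OF f] subset_refl S]
      by (meson add.finprod_one_eqI)
    have \<gamma>G: "\<gamma> \<in> carrier G"
      using \<gamma>(1) S by auto
    then have "inv\<^bsub>G\<^esub> \<gamma> \<otimes>\<^bsub>G\<^esub> \<rho> \<in> supp A G g"
      using \<gamma>(2) \<rho> B_apply_closed[OF f] by (auto simp: supp_def)
    moreover have "\<rho> = \<gamma> \<otimes>\<^bsub>G\<^esub> (inv\<^bsub>G\<^esub> \<gamma> \<otimes>\<^bsub>G\<^esub> \<rho>)"
      using \<gamma>G \<rho> by (simp flip: G.m_assoc)
    ultimately show "\<rho> \<in> (\<lambda>(\<gamma>, \<mu>). \<gamma> \<otimes>\<^bsub>G\<^esub> \<mu>) ` (?S \<times> supp A G g)"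
      using \<gamma>(1) by force
  qed
  then have "finite (supp A G (f \<otimes>\<^bsub>B\<^esub> g))"
    by (rule finite_subset) (simp add: B_finite_supp f g)
  moreover have "(f \<otimes>\<^bsub>B\<^esub> g) \<rho> \<in> carrier A" if \<rho>: "\<rho> \<in> carrier G" for \<rho>
    unfolding B_mult_apply[OF f g \<rho> B_finite_supp[OF f] subset_refl S]
    using S f g \<rho> by (intro finsum_closed) (auto simp: B_apply_closed subset_iff)
  ultimately show ?thesis
    using B_mult_extensional by (auto simp: B_carrier PiE_def)
qed

lemma B_smult_closed: "f \<in> carrier B \<Longrightarrow> c \<odot>\<^bsub>B\<^esub> f \<in> carrier B"
  unfolding B_smult by (rule diagonal_closed) auto

text \<open>The closed formulas for \<open>cp_sigma\<close>, \<open>cp_delta\<close> and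
  \<open>cp_functional\<close> hold on the carrier of \<open>B\<close> only; this transfers
  linearity from the formula to the map.\<close>

lemma linear_map_B_cong:
  assumes "linear_map B V h" "\<And>f. f \<in> carrier B \<Longrightarrow> h' f = h f"
  shows "linear_map B V h'"
  using assms by (simp add: linear_map_def B_add_closed B_smult_closed Pi_iff)

lemma linear_map_self_zero: "linear_map A A h \<Longrightarrow> h \<zero> = \<zero>"
  by (rule linear_map_zero[OF abelian_group_axioms abelian_group_axioms])

lemma functional_zero: "linear_map A complexes \<tau> \<Longrightarrow> \<tau> \<zero> = 0"
  using linear_map_zero[OF abelian_group_axioms C.R.abelian_group_axioms] by simp

lemma linear_map_finsum:
  assumes "linear_map A A h" "finite S" "F \<in> S \<rightarrow> carrier A"
  shows "h (\<Oplus>i\<in>S. F i) = (\<Oplus>i\<in>S. h (F i))"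
  using assms linear_map_self_zero[OF assms(1)]
  by (intro additive_finsum[OF abelian_monoid_axioms abelian_monoid_axioms, where h = h])
    (auto simp: linear_map_def)

text \<open>Moves a coefficient map inside the convolution sum. It is applied to left multiplication
  by \<open>inv (j \<rho>)\<close> and to \<open>D \<rho>\<close>.\<close>

lemma linear_map_B_mult_apply:
  assumes h: "linear_map A A h" and f: "f \<in> carrier B" and g: "g \<in> carrier B"
    and \<rho>: "\<rho> \<in> carrier G"
  shows "h ((f \<otimes>\<^bsub>B\<^esub> g) \<rho>) = (\<Oplus>\<gamma>\<in>supp A G f.
    h (act (f \<gamma>) (inv\<^bsub>G\<^esub> \<gamma> \<otimes>\<^bsub>G\<^esub> \<rho>) \<otimes> g (inv\<^bsub>G\<^esub> \<gamma> \<otimes>\<^bsub>G\<^esub> \<rho>)))"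
proof -
  have S: "supp A G f \<subseteq> carrier G"
    by (auto simp: supp_def)
  show ?thesis
    unfolding B_mult_apply[OF f g \<rho> B_finite_supp[OF f] subset_refl S]
    using S f g \<rho> B_finite_supp[OF f]
    by (intro linear_map_finsum h) (auto simp: B_apply_closed subset_iff)
qed

lemma linear_mult_left:
  assumes z: "z \<in> carrier A"
  shows "linear_map A A (\<lambda>a. z \<otimes> a)"
  using z by (auto simp: linear_map_def r_distr smult_mult_right)

section \<open>The functional on the crossed product\<close>

text \<open>Only the summand at 1 can be nonzero; if 1 is outside the support, both sides vanish
  because \<tau> is linear.\<close>

lemma cp_functional_apply:
  assumes \<tau>: "linear_map A complexes \<tau>" and f: "f \<in> carrier B"
  shows "cp_functional A G \<tau> f = \<tau> (f \<one>\<^bsub>G\<^esub>)"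
proof (cases "\<one>\<^bsub>G\<^esub> \<in> supp A G f")
  case True
  have "cp_functional A G \<tau> f
      = finsum complexes (\<lambda>\<gamma>. if \<one>\<^bsub>G\<^esub> = \<gamma> then \<tau> (f \<gamma>) else \<zero>\<^bsub>complexes\<^esub>) (supp A G f)"
    unfolding cp_functional_def lin_ext_def by (intro C.R.finsum_cong') auto
  also have "\<dots> = \<tau> (f \<one>\<^bsub>G\<^esub>)"
    using True B_finite_supp[OF f] by (intro C.R.finsum_singleton) auto
  finally show ?thesis .
next
  case False
  then have "f \<one>\<^bsub>G\<^esub> = \<zero>"
    by (simp add: supp_def)
  moreover have "cp_functional A G \<tau> f = finsum complexes (\<lambda>\<gamma>. \<zero>\<^bsub>complexes\<^esub>) (supp A G f)"
    unfolding cp_functional_def lin_ext_def using False by (intro C.R.finsum_cong') auto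
  ultimately show ?thesis
    \<comment> \<open>\<open>finsum_zero\<close> has to fire while the zero of
      \<open>complexes\<close> is still unsimplified, hence two rounds.\<close>
    using functional_zero[OF \<tau>] by (simp add: C.R.finsum_zero del: complexes_simps(2)) simp
qed

lemma cp_functional_linear:
  assumes \<tau>: "linear_map A complexes \<tau>"
  shows "linear_map B complexes (cp_functional A G \<tau>)"
proof (rule linear_map_B_cong)
  show "linear_map B complexes (\<lambda>f. \<tau> (f \<one>\<^bsub>G\<^esub>))"
    using \<tau> by (auto simp: linear_map_def B_add B_smult B_apply_closed)
qed (rule cp_functional_apply[OF \<tau>])

section \<open>The automorphism \<sigma>\<close>

context
  fixes j assumes j: "one_cocycle A G act j"
begin

lemma cp_sigma_eq:
  assumes f: "f \<in> carrier B"
  shows "cp_sigma A G act j f = (\<lambda>\<rho>\<in>carrier G. inv (j \<rho>) \<otimes> f \<rho>)"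
  unfolding cp_sigma_def
  using cocycle_unit[OF j] act_cocycle_inv[OF j] f
  by (intro lin_ext_diagonal) auto

lemma cp_sigma_closed: "f \<in> carrier B \<Longrightarrow> cp_sigma A G act j f \<in> carrier B"
  unfolding cp_sigma_eq using cocycle_unit[OF j] by (intro diagonal_closed) auto

lemma cp_sigma_linear: "linear_map B B (cp_sigma A G act j)"
  by (rule linear_map_B_cong[OF diagonal_linear cp_sigma_eq])
    (auto intro: linear_mult_left simp: cocycle_unit[OF j])

text \<open>Both sides are sums over the support of \<open>f\<close> and agree termwise: for \<rho>
  = \<gamma>\<mu> the cocycle identity splits \<open>inv (j \<rho>)\<close> into a factor for
  \<open>f \<gamma>\<close> and the factor \<open>inv (j \<mu>)\<close>, which is central and so can
  move over to \<open>g \<mu>\<close>.\<close>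

lemma cp_sigma_mult:
  assumes f: "f \<in> carrier B" and g: "g \<in> carrier B"
  shows "cp_sigma A G act j (f \<otimes>\<^bsub>B\<^esub> g) = cp_sigma A G act j f \<otimes>\<^bsub>B\<^esub> cp_sigma A G act j g"
proof (rule B_eqI)
  let ?\<sigma> = "cp_sigma A G act j" and ?S = "supp A G f"
  note j' = one_cocycle_inv[OF j]
  have S: "?S \<subseteq> carrier G"
    by (auto simp: supp_def)
  have fg: "f \<otimes>\<^bsub>B\<^esub> g \<in> carrier B"
    using f g by (rule B_mult_closed)
  fix \<rho> assume \<rho>: "\<rho> \<in> carrier G"
  have jcl: "inv (j \<rho>) \<in> carrier A"
    using cocycle_closed[OF j' \<rho>] .
  have sub: "supp A G (?\<sigma> f) \<subseteq> ?S"
    using cocycle_unit[OF j] by (auto simp: supp_def cp_sigma_eq[OF f])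
  have "?\<sigma> (f \<otimes>\<^bsub>B\<^esub> g) \<rho> = (\<Oplus>\<gamma>\<in>?S.
      inv (j \<rho>) \<otimes> (act (f \<gamma>) (inv\<^bsub>G\<^esub> \<gamma> \<otimes>\<^bsub>G\<^esub> \<rho>) \<otimes> g (inv\<^bsub>G\<^esub> \<gamma> \<otimes>\<^bsub>G\<^esub> \<rho>)))"
    using \<rho> linear_map_B_mult_apply[OF linear_mult_left[OF jcl] f g \<rho>]
    by (simp add: cp_sigma_eq[OF fg])
  also have "\<dots> = (\<Oplus>\<gamma>\<in>?S. act (?\<sigma> f \<gamma>) (inv\<^bsub>G\<^esub> \<gamma> \<otimes>\<^bsub>G\<^esub> \<rho>) \<otimes> ?\<sigma> g (inv\<^bsub>G\<^esub> \<gamma> \<otimes>\<^bsub>G\<^esub> \<rho>))"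
  proof (intro finsum_cong' refl)
    fix \<gamma> assume "\<gamma> \<in> ?S"
    then have \<gamma>: "\<gamma> \<in> carrier G"
      using S by auto
    define \<mu> where "\<mu> = inv\<^bsub>G\<^esub> \<gamma> \<otimes>\<^bsub>G\<^esub> \<rho>"
    have \<mu>: "\<mu> \<in> carrier G" "\<rho> = \<gamma> \<otimes>\<^bsub>G\<^esub> \<mu>"
      using \<gamma> \<rho> by (simp_all add: \<mu>_def flip: G.m_assoc)
    have cl: "f \<gamma> \<in> carrier A" "g \<mu> \<in> carrier A" "inv (j \<gamma>) \<in> carrier A" "inv (j \<mu>) \<in> carrier A"
      using \<gamma> \<mu> f g cocycle_closed[OF j'] by (auto simp: B_apply_closed)
    show "inv (j \<rho>) \<otimes> (act (f \<gamma>) (inv\<^bsub>G\<^esub> \<gamma> \<otimes>\<^bsub>G\<^esub> \<rho>) \<otimes> g (inv\<^bsub>G\<^esub> \<gamma> \<otimes>\<^bsub>G\<^esub> \<rho>))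
        = act (?\<sigma> f \<gamma>) (inv\<^bsub>G\<^esub> \<gamma> \<otimes>\<^bsub>G\<^esub> \<rho>) \<otimes> ?\<sigma> g (inv\<^bsub>G\<^esub> \<gamma> \<otimes>\<^bsub>G\<^esub> \<rho>)"
      unfolding \<mu>_def[symmetric]
      using \<gamma> \<mu> cl cocycle_mult_eq[OF j' \<gamma> \<mu>(1)] center_lcomm[OF cocycle_center[OF j' \<mu>(1)]]
      by (simp add: cp_sigma_eq f g act_mult m_assoc)
  qed (use S \<rho> cp_sigma_closed f g in \<open>auto simp: B_apply_closed subset_iff\<close>)
  also have "\<dots> = (?\<sigma> f \<otimes>\<^bsub>B\<^esub> ?\<sigma> g) \<rho>"
    using f g \<rho> B_finite_supp[OF f] sub S
    by (intro B_mult_apply[symmetric] cp_sigma_closed)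
  finally show "?\<sigma> (f \<otimes>\<^bsub>B\<^esub> g) \<rho> = (?\<sigma> f \<otimes>\<^bsub>B\<^esub> ?\<sigma> g) \<rho>" .
qed (use f g in \<open>simp_all add: cp_sigma_eq B_mult_closed B_mult_extensional\<close>)

lemma cp_sigma_one: "cp_sigma A G act j \<one>\<^bsub>B\<^esub> = \<one>\<^bsub>B\<^esub>"
proof -
  have "\<one>\<^bsub>B\<^esub> \<in> carrier B"
    by (simp add: B_one tensor_closed)
  moreover have "inv (j \<rho>) \<in> carrier A" if "\<rho> \<in> carrier G" for \<rho>
    using cocycle_closed[OF one_cocycle_inv[OF j] that] .
  ultimately show ?thesis
    by (auto simp: cp_sigma_eq B_one tensor_def cocycle_one[OF j] intro!: restrict_ext)
qed

lemma cp_sigma_automorphism: "algebra_automorphism B (cp_sigma A G act j)"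
proof -
  have "bij_betw (cp_sigma A G act j) (carrier B) (carrier B)"
  proof (rule bij_betwI)
    \<comment> \<open>The inverse of \<sigma> undoes the multiplication by
      \<open>inv (j \<rho>)\<close> in each coefficient.\<close>
    let ?g = "\<lambda>f. \<lambda>\<rho>\<in>carrier G. j \<rho> \<otimes> f \<rho>"
    show g: "?g \<in> carrier B \<rightarrow> carrier B"
      using cocycle_closed[OF j] by (intro funcsetI diagonal_closed) auto
    fix f assume f: "f \<in> carrier B"
    have [simp]: "inv (j \<rho>) \<otimes> (j \<rho> \<otimes> f \<rho>) = f \<rho>" "j \<rho> \<otimes> (inv (j \<rho>) \<otimes> f \<rho>) = f \<rho>"
      if "\<rho> \<in> carrier G" for \<rho>
      using cocycle_unit[OF j that] cocycle_closed[OF j that] B_apply_closed[OF f that]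
      by (simp_all flip: m_assoc)
    show "?g (cp_sigma A G act j f) = f"
      by (rule B_eqI) (simp_all add: cp_sigma_eq f B_extensional)
    have "?g f \<in> carrier B"
      using g f by blast
    from cp_sigma_eq[OF this] show "cp_sigma A G act j (?g f) = f"
      by (intro B_eqI) (simp_all add: f B_extensional)
  qed (use cp_sigma_closed in auto)
  then show ?thesis
    unfolding algebra_automorphism_def ring_iso_def ring_hom_def
    using cp_sigma_linear cp_sigma_closed cp_sigma_mult cp_sigma_one
    by (auto simp: linear_map_add)
qed

section \<open>The \<sigma>-trace property\<close>

text \<open>This is the \<sigma>-trace identity for the elementary tensors of \<open>a\<close> at
  the inverse of \<mu> and of \<open>b\<close> at \<mu>. Applying \<mu> to \<open>?x\<close> and
  multiplying by the central \<open>j \<mu>\<close> cancels \<open>inv (j \<mu>)\<close> and leaves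
  \<open>b \<otimes> act a \<mu>\<close>.\<close>

lemma change_of_variable_swap:
  assumes \<tau>: "alg_trace A \<tau>" "change_of_variable A G act j \<tau>"
    and a: "a \<in> carrier A" and b: "b \<in> carrier A" and \<mu>: "\<mu> \<in> carrier G"
  shows "\<tau> (act a \<mu> \<otimes> b) = \<tau> (act (inv (j \<mu>) \<otimes> b) (inv\<^bsub>G\<^esub> \<mu>) \<otimes> a)"
proof -
  let ?x = "act (inv (j \<mu>) \<otimes> b) (inv\<^bsub>G\<^esub> \<mu>) \<otimes> a"
  have cl: "inv (j \<mu>) \<in> carrier A" "j \<mu> \<in> carrier A" "act a \<mu> \<in> carrier A"
    using cocycle_unit[OF j \<mu>] a \<mu> by auto
  have "act ?x \<mu> \<otimes> j \<mu> = (inv (j \<mu>) \<otimes> b \<otimes> act a \<mu>) \<otimes> j \<mu>"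
    using a b \<mu> cl by (simp add: act_mult[of _ a] act_act)
  also have "\<dots> = (j \<mu> \<otimes> inv (j \<mu>)) \<otimes> (b \<otimes> act a \<mu>)"
    using b cl center_comm[OF cocycle_center[OF j \<mu>], of "inv (j \<mu>) \<otimes> b \<otimes> act a \<mu>"]
    by (simp add: m_assoc)
  also have "\<dots> = b \<otimes> act a \<mu>"
    using b cl cocycle_unit[OF j \<mu>] by simp
  finally have "act ?x \<mu> \<otimes> j \<mu> = b \<otimes> act a \<mu>" .
  moreover have "\<tau> (act ?x \<mu> \<otimes> j \<mu>) = \<tau> ?x"
    using \<tau>(2) a b \<mu> cl by (simp add: change_of_variable_def)
  moreover have "\<tau> (act a \<mu> \<otimes> b) = \<tau> (b \<otimes> act a \<mu>)"
    using \<tau>(1) b cl by (simp add: sigma_trace_def)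
  ultimately show ?thesis by simp
qed

lemma cp_functional_sigma_trace:
  assumes \<tau>: "alg_trace A \<tau>" "change_of_variable A G act j \<tau>"
  shows "sigma_trace B (cp_sigma A G act j) (cp_functional A G \<tau>)"
  unfolding sigma_trace_def
proof (intro conjI ballI)
  let ?\<sigma> = "cp_sigma A G act j"
  have lin: "linear_map A complexes \<tau>"
    using \<tau>(1) by (simp add: sigma_trace_def)
  then show "linear_map B complexes (cp_functional A G \<tau>)"
    by (rule cp_functional_linear)
  have \<tau>_finsum: "\<tau> (\<Oplus>i\<in>S. F i) = finsum complexes (\<lambda>i. \<tau> (F i)) S"
    if "finite S" "F \<in> S \<rightarrow> carrier A" for S :: "'g set" and F
    using that functional_zero[OF lin] linear_map_add[OF lin]
    by (intro additive_finsum[OF abelian_monoid_axioms C.R.abelian_monoid_axioms, where h = \<tau>]) auto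
  fix f g assume f: "f \<in> carrier B" and g: "g \<in> carrier B"
  \<comment> \<open>At 1 the left factor's index \<gamma> pairs with its inverse. \<open>S\<close>
    covers the support of \<open>f\<close>, and its set of inverses \<open>S'\<close> covers that of
    \<open>?\<sigma> g\<close>, so both products become sums over \<open>S\<close> related by
    inversion.\<close>
  define S where "S = supp A G f \<union> (\<lambda>\<mu>. inv\<^bsub>G\<^esub> \<mu>) ` supp A G g"
  define S' where "S' = (\<lambda>\<gamma>. inv\<^bsub>G\<^esub> \<gamma>) ` S"
  have S: "finite S" "supp A G f \<subseteq> S" "S \<subseteq> carrier G"
    using B_finite_supp f g by (auto simp: S_def) (auto simp: supp_def)
  have inj: "inj_on (\<lambda>\<gamma>. inv\<^bsub>G\<^esub> \<gamma>) S"
    using S(3) G.inv_inj inj_on_subset by blast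
  have "supp A G (?\<sigma> g) \<subseteq> supp A G g"
    using cocycle_unit[OF j] by (auto simp: supp_def cp_sigma_eq[OF g])
  also have "\<dots> \<subseteq> S'"
  proof
    fix \<mu> assume "\<mu> \<in> supp A G g"
    moreover from this have "\<mu> = inv\<^bsub>G\<^esub> (inv\<^bsub>G\<^esub> \<mu>)"
      by (simp add: supp_def)
    ultimately show "\<mu> \<in> S'"
      unfolding S'_def S_def by blast
  qed
  finally have S': "finite S'" "supp A G (?\<sigma> g) \<subseteq> S'" "S' \<subseteq> carrier G"
    using S by (auto simp: S'_def)
  have \<sigma>g: "?\<sigma> g \<in> carrier B"
    using g by (rule cp_sigma_closed)
  have cl: "f \<gamma> \<in> carrier A" "g (inv\<^bsub>G\<^esub> \<gamma>) \<in> carrier A" "?\<sigma> g (inv\<^bsub>G\<^esub> \<gamma>) \<in> carrier A"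
    "\<gamma> \<in> carrier G" if "\<gamma> \<in> S" for \<gamma>
    using that S(3) f g \<sigma>g by (auto simp: B_apply_closed)
  have "(f \<otimes>\<^bsub>B\<^esub> g) \<one>\<^bsub>G\<^esub> = (\<Oplus>\<gamma>\<in>S. act (f \<gamma>) (inv\<^bsub>G\<^esub> \<gamma>) \<otimes> g (inv\<^bsub>G\<^esub> \<gamma>))"
    unfolding B_mult_apply[OF f g G.one_closed S]
    using cl by (intro finsum_cong') auto
  then have "\<tau> ((f \<otimes>\<^bsub>B\<^esub> g) \<one>\<^bsub>G\<^esub>)
      = finsum complexes (\<lambda>\<gamma>. \<tau> (act (f \<gamma>) (inv\<^bsub>G\<^esub> \<gamma>) \<otimes> g (inv\<^bsub>G\<^esub> \<gamma>))) S"
    using \<tau>_finsum[OF S(1), of "\<lambda>\<gamma>. act (f \<gamma>) (inv\<^bsub>G\<^esub> \<gamma>) \<otimes> g (inv\<^bsub>G\<^esub> \<gamma>)"] cl by auto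
  also have "\<dots> = finsum complexes (\<lambda>\<gamma>. \<tau> (act (?\<sigma> g (inv\<^bsub>G\<^esub> \<gamma>)) \<gamma> \<otimes> f \<gamma>)) S"
  proof (intro C.R.finsum_cong' refl)
    fix \<gamma> assume "\<gamma> \<in> S"
    note cl = cl[OF this]
    then show "\<tau> (act (f \<gamma>) (inv\<^bsub>G\<^esub> \<gamma>) \<otimes> g (inv\<^bsub>G\<^esub> \<gamma>)) = \<tau> (act (?\<sigma> g (inv\<^bsub>G\<^esub> \<gamma>)) \<gamma> \<otimes> f \<gamma>)"
      using change_of_variable_swap[OF \<tau> cl(1,2), of "inv\<^bsub>G\<^esub> \<gamma>"] by (simp add: cp_sigma_eq g)
  qed simp
  also have "\<dots> = \<tau> (\<Oplus>\<gamma>\<in>S. act (?\<sigma> g (inv\<^bsub>G\<^esub> \<gamma>)) \<gamma> \<otimes> f \<gamma>)"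
    using cl by (intro \<tau>_finsum[symmetric] S(1)) auto
  \<comment> \<open>The summand is brought into the shape of the product formula at 1 with index the
    inverse of \<gamma>, ready for reindexing from \<open>S\<close> to \<open>S'\<close>.\<close>
  also have "(\<Oplus>\<gamma>\<in>S. act (?\<sigma> g (inv\<^bsub>G\<^esub> \<gamma>)) \<gamma> \<otimes> f \<gamma>)
      = (\<Oplus>\<gamma>\<in>S. act (?\<sigma> g (inv\<^bsub>G\<^esub> \<gamma>)) (inv\<^bsub>G\<^esub> (inv\<^bsub>G\<^esub> \<gamma>) \<otimes>\<^bsub>G\<^esub> \<one>\<^bsub>G\<^esub>)
          \<otimes> f (inv\<^bsub>G\<^esub> (inv\<^bsub>G\<^esub> \<gamma>) \<otimes>\<^bsub>G\<^esub> \<one>\<^bsub>G\<^esub>))"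
    using cl by (intro finsum_cong') auto
  also have "\<dots> = (?\<sigma> g \<otimes>\<^bsub>B\<^esub> f) \<one>\<^bsub>G\<^esub>"
    unfolding B_mult_apply[OF \<sigma>g f G.one_closed S'] unfolding S'_def
    using cl by (intro finsum_reindex[OF _ inj, symmetric]) auto
  finally show "cp_functional A G \<tau> (f \<otimes>\<^bsub>B\<^esub> g) = cp_functional A G \<tau> (?\<sigma> g \<otimes>\<^bsub>B\<^esub> f)"
    using f g \<sigma>g by (simp add: cp_functional_apply[OF lin] B_mult_closed)
qed

section \<open>The twisted Leibniz rule on coefficients\<close>

text \<open>The cocycle \<open>p\<close> splits the argument of \<delta> into
  \<open>act (a \<otimes> p \<gamma>) \<mu>\<close> times \<open>b \<otimes> p \<mu>\<close>, and
  the ordinary Leibniz rule applies. In the first term the twisting hypothesis produces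
  \<open>j \<mu>\<close>, which cancels against \<open>p \<mu> \<otimes> q \<mu>\<close>; in the
  second, the images of \<open>p \<gamma>\<close> and \<open>q \<gamma>\<close> under \<mu> combine
  to that of \<open>inv (j \<gamma>)\<close>, the factor belonging to \<sigma>.\<close>

lemma derivation_twisted_leibniz:
  assumes p: "one_cocycle A G act p" and q: "one_cocycle A G act q"
    and pq: "\<And>\<gamma>. \<gamma> \<in> carrier G \<Longrightarrow> p \<gamma> \<otimes> q \<gamma> = inv (j \<gamma>)"
    and \<delta>: "derivation A \<delta>"
      "\<And>a \<gamma>. \<lbrakk>a \<in> carrier A; \<gamma> \<in> carrier G\<rbrakk> \<Longrightarrow> \<delta> (act a \<gamma>) = act (\<delta> a) \<gamma> \<otimes> j \<gamma>"
    and a: "a \<in> carrier A" and b: "b \<in> carrier A"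
    and \<gamma>: "\<gamma> \<in> carrier G" and \<mu>: "\<mu> \<in> carrier G"
  shows "\<delta> (act a \<mu> \<otimes> b \<otimes> p (\<gamma> \<otimes>\<^bsub>G\<^esub> \<mu>)) \<otimes> q (\<gamma> \<otimes>\<^bsub>G\<^esub> \<mu>)
    = act (\<delta> (a \<otimes> p \<gamma>) \<otimes> q \<gamma>) \<mu> \<otimes> b \<oplus> act (inv (j \<gamma>) \<otimes> a) \<mu> \<otimes> (\<delta> (b \<otimes> p \<mu>) \<otimes> q \<mu>)"
proof -
  have \<delta>_closed: "\<delta> x \<in> carrier A" if "x \<in> carrier A" for x
    using \<delta>(1) that by (auto simp: sigma_derivation_def linear_map_def)
  have leibniz: "\<delta> (x \<otimes> y) = \<delta> x \<otimes> y \<oplus> x \<otimes> \<delta> y" if "x \<in> carrier A" "y \<in> carrier A" for x y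
    using \<delta>(1) that by (simp add: sigma_derivation_def)
  define \<alpha> p' q' X Y where "\<alpha> = act a \<mu>" and "p' = act (p \<gamma>) \<mu>" and "q' = act (q \<gamma>) \<mu>"
    and "X = act (\<delta> (a \<otimes> p \<gamma>)) \<mu>" and "Y = \<delta> (b \<otimes> p \<mu>)"
  note defs = this
  note cl0 = cocycle_closed[OF p] cocycle_closed[OF q] cocycle_closed[OF j] a b \<gamma> \<mu> \<delta>_closed
  have cl: "\<alpha> \<in> carrier A" "p' \<in> carrier A" "q' \<in> carrier A" "X \<in> carrier A" "Y \<in> carrier A"
    "p \<mu> \<in> carrier A" "q \<mu> \<in> carrier A" "j \<mu> \<in> carrier A"
    by (simp_all add: defs cl0)
  note cen = cocycle_center[OF p \<mu>] cocycle_center[OF q \<mu>]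
  have cen': "p' \<in> alg_center A" "q' \<in> alg_center A"
    unfolding defs
    using act_center[OF cocycle_center[OF p \<gamma>] \<mu>] act_center[OF cocycle_center[OF q \<gamma>] \<mu>] .
  have inv_j: "j \<mu> \<otimes> (p \<mu> \<otimes> q \<mu>) = \<one>"
    using pq[OF \<mu>] cocycle_unit[OF j \<mu>] by simp
  \<comment> \<open>The central \<open>p'\<close> moves left past \<open>b\<close> to join
    \<alpha>.\<close>
  have "\<alpha> \<otimes> b \<otimes> (p' \<otimes> p \<mu>) = act (a \<otimes> p \<gamma>) \<mu> \<otimes> (b \<otimes> p \<mu>)"
    using cl cl0 center_lcomm[OF cen'(1) b cl(6)]
    by (simp add: act_mult m_assoc flip: defs)
  then have "\<delta> (\<alpha> \<otimes> b \<otimes> (p' \<otimes> p \<mu>))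
      = \<delta> (act (a \<otimes> p \<gamma>) \<mu>) \<otimes> (b \<otimes> p \<mu>) \<oplus> act (a \<otimes> p \<gamma>) \<mu> \<otimes> Y"
    using cl0 by (simp add: leibniz[of "act (a \<otimes> p \<gamma>) \<mu>"] defs(5))
  also have "\<delta> (act (a \<otimes> p \<gamma>) \<mu>) = X \<otimes> j \<mu>"
    using cl0 by (simp add: defs(4) \<delta>(2))
  also have "act (a \<otimes> p \<gamma>) \<mu> = \<alpha> \<otimes> p'"
    using cl0 by (simp add: defs(1,2) act_mult)
  finally have "\<delta> (\<alpha> \<otimes> b \<otimes> (p' \<otimes> p \<mu>)) \<otimes> (q' \<otimes> q \<mu>)
      = (X \<otimes> j \<mu>) \<otimes> (b \<otimes> p \<mu>) \<otimes> (q' \<otimes> q \<mu>) \<oplus> (\<alpha> \<otimes> p') \<otimes> Y \<otimes> (q' \<otimes> q \<mu>)"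
    using cl b by (simp add: l_distr)
  moreover have "(X \<otimes> j \<mu>) \<otimes> (b \<otimes> p \<mu>) \<otimes> (q' \<otimes> q \<mu>) = act (\<delta> (a \<otimes> p \<gamma>) \<otimes> q \<gamma>) \<mu> \<otimes> b"
  proof -
    have "(X \<otimes> j \<mu>) \<otimes> (b \<otimes> p \<mu>) \<otimes> (q' \<otimes> q \<mu>)
        = q' \<otimes> ((X \<otimes> j \<mu>) \<otimes> (b \<otimes> p \<mu>) \<otimes> q \<mu>)"
      using cl b by (intro center_lcomm cen') simp_all
    also have "(X \<otimes> j \<mu>) \<otimes> (b \<otimes> p \<mu>) \<otimes> q \<mu> = X \<otimes> (j \<mu> \<otimes> (b \<otimes> (p \<mu> \<otimes> q \<mu>)))"
      using cl b by (simp add: m_assoc)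
    also have "b \<otimes> (p \<mu> \<otimes> q \<mu>) = (p \<mu> \<otimes> q \<mu>) \<otimes> b"
      by (intro center_comm center_mult cen b)
    also have "j \<mu> \<otimes> ((p \<mu> \<otimes> q \<mu>) \<otimes> b) = b"
      using inv_j cl b by (simp flip: m_assoc)
    also have "q' \<otimes> (X \<otimes> b) = (X \<otimes> q') \<otimes> b"
      using cl b center_lcomm[OF cen'(2) cl(4) b] by (simp add: m_assoc)
    also have "X \<otimes> q' = act (\<delta> (a \<otimes> p \<gamma>) \<otimes> q \<gamma>) \<mu>"
      using cl0 by (simp add: defs act_mult)
    finally show ?thesis .
  qed
  moreover have "(\<alpha> \<otimes> p') \<otimes> Y \<otimes> (q' \<otimes> q \<mu>) = act (inv (j \<gamma>) \<otimes> a) \<mu> \<otimes> (Y \<otimes> q \<mu>)"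
  proof -
    have "(\<alpha> \<otimes> p') \<otimes> Y \<otimes> (q' \<otimes> q \<mu>) = (\<alpha> \<otimes> p') \<otimes> (q' \<otimes> (Y \<otimes> q \<mu>))"
      using cl center_lcomm[OF cen'(2) cl(5,7)] by (simp add: m_assoc)
    also have "\<dots> = (\<alpha> \<otimes> (p' \<otimes> q')) \<otimes> (Y \<otimes> q \<mu>)"
      using cl by (simp add: m_assoc)
    also have "\<alpha> \<otimes> (p' \<otimes> q') = (p' \<otimes> q') \<otimes> \<alpha>"
      by (intro center_comm center_mult cen' cl)
    also have "p' \<otimes> q' = act (inv (j \<gamma>)) \<mu>"
      using cl0 by (simp add: defs flip: act_mult pq)
    also have "act (inv (j \<gamma>)) \<mu> \<otimes> \<alpha> = act (inv (j \<gamma>) \<otimes> a) \<mu>"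
      using cl0 cocycle_unit[OF j \<gamma>] by (simp add: defs act_mult)
    finally show ?thesis .
  qed
  ultimately show ?thesis
    using cocycle_mult_eq[OF p \<gamma> \<mu>] cocycle_mult_eq[OF q \<gamma> \<mu>] by (simp add: defs)
qed

context
  fixes \<delta> :: "'a \<Rightarrow> 'a" and s :: nat
  assumes \<delta>: "derivation A \<delta>"
    and \<delta>_act: "\<And>a \<gamma>. \<lbrakk>a \<in> carrier A; \<gamma> \<in> carrier G\<rbrakk> \<Longrightarrow> \<delta> (act a \<gamma>) = act (\<delta> a) \<gamma> \<otimes> j \<gamma>"
begin

definition "P \<gamma> = inv (j \<gamma> [^] s)"
text \<open>This is \<open>j \<gamma>\<close> to the integer power s - 1; the product form avoids
  truncated subtraction and is visibly a product of cocycles.\<close>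

definition "Q \<gamma> = inv (j \<gamma>) \<otimes> j \<gamma> [^] s"

lemma P_cocycle: "one_cocycle A G act P"
  unfolding P_def by (intro one_cocycle_inv one_cocycle_pow j)

lemma Q_cocycle: "one_cocycle A G act Q"
  unfolding Q_def by (intro one_cocycle_mult one_cocycle_inv one_cocycle_pow j)

lemma P_mult_Q:
  assumes "\<gamma> \<in> carrier G"
  shows "P \<gamma> \<otimes> Q \<gamma> = inv (j \<gamma>)"
proof -
  note js = one_cocycle_pow[OF j, of s]
  have cl: "inv (j \<gamma>) \<in> carrier A" "j \<gamma> [^] s \<in> carrier A" "P \<gamma> \<in> carrier A"
    using assms cocycle_unit[OF j] cocycle_closed[OF js] cocycle_closed[OF P_cocycle] by auto
  then have "P \<gamma> \<otimes> Q \<gamma> = inv (j \<gamma>) \<otimes> (P \<gamma> \<otimes> j \<gamma> [^] s)"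
    unfolding Q_def by (intro center_lcomm cocycle_center[OF one_cocycle_inv[OF j] assms])
  also have "\<dots> = inv (j \<gamma>)"
    using cocycle_unit[OF js assms] cl by (simp add: P_def)
  finally show ?thesis .
qed

lemma \<delta>_linear: "linear_map A A \<delta>"
  using \<delta> by (simp add: sigma_derivation_def)

lemma \<delta>_closed: "a \<in> carrier A \<Longrightarrow> \<delta> a \<in> carrier A"
  using linear_map_closed[OF \<delta>_linear] .

lemma \<delta>_mult: "\<lbrakk>a \<in> carrier A; b \<in> carrier A\<rbrakk> \<Longrightarrow> \<delta> (a \<otimes> b) = \<delta> a \<otimes> b \<oplus> a \<otimes> \<delta> b"
  using \<delta> by (simp add: sigma_derivation_def)

lemma \<delta>_one: "\<delta> \<one> = \<zero>"
  using \<delta>_mult[of \<one> \<one>] \<delta>_closed[of \<one>] by simp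

definition "D \<gamma> a = \<delta> (a \<otimes> P \<gamma>) \<otimes> Q \<gamma>"

lemma D_linear:
  assumes "\<gamma> \<in> carrier G"
  shows "linear_map A A (D \<gamma>)"
  using cocycle_closed[OF P_cocycle assms] cocycle_closed[OF Q_cocycle assms]
  by (auto simp: linear_map_def D_def \<delta>_closed l_distr linear_map_add[OF \<delta>_linear]
      linear_map_smult[OF \<delta>_linear] smult_mult_left)

lemma D_closed: "\<lbrakk>a \<in> carrier A; \<gamma> \<in> carrier G\<rbrakk> \<Longrightarrow> D \<gamma> a \<in> carrier A"
  using linear_map_closed[OF D_linear] .

lemma D_one: "a \<in> carrier A \<Longrightarrow> D \<one>\<^bsub>G\<^esub> a = \<delta> a"
  by (simp add: D_def cocycle_one[OF P_cocycle] cocycle_one[OF Q_cocycle] \<delta>_closed)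

text \<open>The coefficient in the definition of \<open>cp_delta\<close> sits to the left of \<open>\<gamma>\<close>; moving it across
  applies \<open>\<gamma>\<close> to it, and the twisting hypothesis on \<open>\<delta>\<close> turns the result into \<open>D \<gamma>\<close>.\<close>

lemma cp_delta_coeff:
  assumes a: "a \<in> carrier A" and \<gamma>: "\<gamma> \<in> carrier G"
  defines "J \<equiv> j (inv\<^bsub>G\<^esub> \<gamma>) [^] s"
  shows "act (\<delta> (act a (inv\<^bsub>G\<^esub> \<gamma>) \<otimes> J) \<otimes> inv J) \<gamma> = D \<gamma> a"
proof -
  note js = one_cocycle_pow[OF j, of s]
  have cl: "J \<in> carrier A" "inv J \<in> carrier A" "J \<in> Units A"
    using \<gamma> cocycle_unit[OF js, of "inv\<^bsub>G\<^esub> \<gamma>"] by (auto simp: J_def)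
  have \<gamma>_units: "j \<gamma> \<in> Units A" "j \<gamma> [^] s \<in> Units A"
    using \<gamma> cocycle_unit[OF js] cocycle_unit[OF j] by auto
  have actJ: "act J \<gamma> = P \<gamma>"
    unfolding J_def P_def using act_cocycle_inv[OF js \<gamma>] .
  \<comment> \<open>The inverse of the power cocycle is itself a cocycle, so the same evaluation
    applies and gives a double inverse.\<close>
  have act_inv_J: "act (inv J) \<gamma> = j \<gamma> [^] s"
    unfolding J_def using act_cocycle_inv[OF one_cocycle_inv[OF js] \<gamma>] \<gamma>_units by simp
  let ?x = "act a (inv\<^bsub>G\<^esub> \<gamma>) \<otimes> J"
  have x: "?x \<in> carrier A"
    using a \<gamma> cl by simp
  have "act ?x \<gamma> = a \<otimes> P \<gamma>"
    using a \<gamma> cl by (simp add: act_mult act_act actJ)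
  then have "\<delta> (a \<otimes> P \<gamma>) = act (\<delta> ?x) \<gamma> \<otimes> j \<gamma>"
    using \<delta>_act[OF x \<gamma>] by simp
  \<comment> \<open>The twisting hypothesis is solved for \<open>act (\<delta> ?x) \<gamma>\<close>;
    this is the source of the factor \<open>inv (j \<gamma>)\<close> in \<open>Q\<close>.\<close>
  then have "\<delta> (a \<otimes> P \<gamma>) \<otimes> inv (j \<gamma>) = act (\<delta> ?x) \<gamma>"
    using \<gamma> \<gamma>_units \<delta>_closed[OF x] Units_closed by (simp add: m_assoc)
  then have "act (\<delta> ?x \<otimes> inv J) \<gamma> = \<delta> (a \<otimes> P \<gamma>) \<otimes> inv (j \<gamma>) \<otimes> j \<gamma> [^] s"
    using \<gamma> cl \<delta>_closed[OF x] by (simp add: act_mult act_inv_J)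
  also have "\<dots> = D \<gamma> a"
    using \<gamma>_units a \<gamma> cocycle_closed[OF P_cocycle \<gamma>] Units_closed[OF \<gamma>_units(2)]
    by (simp add: D_def Q_def m_assoc \<delta>_closed)
  finally show ?thesis .
qed

lemma cp_delta_eq:
  assumes f: "f \<in> carrier B"
  shows "cp_delta A G act j \<delta> s f = (\<lambda>\<rho>\<in>carrier G. D \<rho> (f \<rho>))"
  unfolding cp_delta_def
proof (rule lin_ext_diagonal[OF _ _ _ f])
  fix \<gamma> assume \<gamma>: "\<gamma> \<in> carrier G"
  show "D \<gamma> \<in> carrier A \<rightarrow> carrier A" "D \<gamma> \<zero> = \<zero>"
    using \<gamma> D_closed linear_map_self_zero[OF D_linear] by auto
  fix a assume a: "a \<in> carrier A"
  let ?J = "j (inv\<^bsub>G\<^esub> \<gamma>) [^] s"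
  have cl: "\<delta> (act a (inv\<^bsub>G\<^esub> \<gamma>) \<otimes> ?J) \<otimes> inv ?J \<in> carrier A"
    using a \<gamma> cocycle_unit[OF one_cocycle_pow[OF j, of s], of "inv\<^bsub>G\<^esub> \<gamma>"] Units_closed
    by (simp add: \<delta>_closed)
  show "tensor A G (\<delta> (act a (inv\<^bsub>G\<^esub> \<gamma>) \<otimes> ?J) \<otimes> inv ?J) \<one>\<^bsub>G\<^esub> \<otimes>\<^bsub>B\<^esub> tensor A G \<one> \<gamma>
      = tensor A G (D \<gamma> a) \<gamma>"
    using tensor_mult_tensor[OF complex_algebra_axioms G.group_axioms action cl one_closed
        G.one_closed \<gamma>] cp_delta_coeff[OF a \<gamma>] D_closed[OF a \<gamma>] \<gamma>
    by simp
qed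

lemma cp_delta_closed: "f \<in> carrier B \<Longrightarrow> cp_delta A G act j \<delta> s f \<in> carrier B"
  unfolding cp_delta_eq
  using D_closed linear_map_self_zero[OF D_linear] by (intro diagonal_closed) auto

text \<open>Both products on the right have left factors supported inside the support of
  \<open>f\<close>. Over that index set the identity holds termwise by
  \<open>derivation_twisted_leibniz\<close>, and the sum then splits in two.\<close>

lemma cp_delta_sigma_derivation:
  "sigma_derivation B (cp_sigma A G act j) (cp_delta A G act j \<delta> s)"
  unfolding sigma_derivation_def
proof (intro conjI ballI)
  let ?\<sigma> = "cp_sigma A G act j" and ?\<delta> = "cp_delta A G act j \<delta> s"
  show "linear_map B B ?\<delta>"
    by (rule linear_map_B_cong[OF diagonal_linear cp_delta_eq]) (rule D_linear)
  fix f g assume f: "f \<in> carrier B" and g: "g \<in> carrier B"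
  let ?S = "supp A G f"
  have S: "?S \<subseteq> carrier G"
    by (auto simp: supp_def)
  have fg: "f \<otimes>\<^bsub>B\<^esub> g \<in> carrier B"
    using f g by (rule B_mult_closed)
  have sub: "supp A G (?\<sigma> f) \<subseteq> ?S" "supp A G (?\<delta> f) \<subseteq> ?S"
    using cocycle_unit[OF j] linear_map_self_zero[OF D_linear]
    by (auto simp: supp_def cp_sigma_eq[OF f] cp_delta_eq[OF f])
  show "?\<delta> (f \<otimes>\<^bsub>B\<^esub> g) = ?\<delta> f \<otimes>\<^bsub>B\<^esub> g \<oplus>\<^bsub>B\<^esub> ?\<sigma> f \<otimes>\<^bsub>B\<^esub> ?\<delta> g"
  proof (rule B_eqI)
    fix \<rho> assume \<rho>: "\<rho> \<in> carrier G"
    let ?\<mu> = "\<lambda>\<gamma>. inv\<^bsub>G\<^esub> \<gamma> \<otimes>\<^bsub>G\<^esub> \<rho>"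
    have cl: "f \<gamma> \<in> carrier A" "?\<sigma> f \<gamma> \<in> carrier A" "?\<delta> f \<gamma> \<in> carrier A" "?\<mu> \<gamma> \<in> carrier G"
      "g (?\<mu> \<gamma>) \<in> carrier A" "?\<delta> g (?\<mu> \<gamma>) \<in> carrier A" "\<gamma> \<in> carrier G" if "\<gamma> \<in> ?S" for \<gamma>
      using that S \<rho> f g cp_sigma_closed cp_delta_closed
      by (auto simp: B_apply_closed subset_iff)
    have "?\<delta> (f \<otimes>\<^bsub>B\<^esub> g) \<rho> = (\<Oplus>\<gamma>\<in>?S. D \<rho> (act (f \<gamma>) (?\<mu> \<gamma>) \<otimes> g (?\<mu> \<gamma>)))"
      using \<rho> linear_map_B_mult_apply[OF D_linear[OF \<rho>] f g \<rho>] by (simp add: cp_delta_eq[OF fg])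
    also have "\<dots> = (\<Oplus>\<gamma>\<in>?S. act (?\<delta> f \<gamma>) (?\<mu> \<gamma>) \<otimes> g (?\<mu> \<gamma>)
        \<oplus> act (?\<sigma> f \<gamma>) (?\<mu> \<gamma>) \<otimes> ?\<delta> g (?\<mu> \<gamma>))"
    proof (intro finsum_cong' refl)
      fix \<gamma> assume "\<gamma> \<in> ?S"
      note cl = cl[OF this]
      have "\<gamma> \<otimes>\<^bsub>G\<^esub> ?\<mu> \<gamma> = \<rho>"
        using cl \<rho> by (simp flip: G.m_assoc)
      then show "D \<rho> (act (f \<gamma>) (?\<mu> \<gamma>) \<otimes> g (?\<mu> \<gamma>))
          = act (?\<delta> f \<gamma>) (?\<mu> \<gamma>) \<otimes> g (?\<mu> \<gamma>) \<oplus> act (?\<sigma> f \<gamma>) (?\<mu> \<gamma>) \<otimes> ?\<delta> g (?\<mu> \<gamma>)"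
        using derivation_twisted_leibniz[OF P_cocycle Q_cocycle P_mult_Q \<delta> \<delta>_act cl(1,5,7,4)] cl
        by (simp add: D_def cp_delta_eq cp_sigma_eq f g)
    qed (use cl in auto)
    also have "\<dots> = (\<Oplus>\<gamma>\<in>?S. act (?\<delta> f \<gamma>) (?\<mu> \<gamma>) \<otimes> g (?\<mu> \<gamma>))
        \<oplus> (\<Oplus>\<gamma>\<in>?S. act (?\<sigma> f \<gamma>) (?\<mu> \<gamma>) \<otimes> ?\<delta> g (?\<mu> \<gamma>))"
      using cl by (intro finsum_addf) auto
    also have "\<dots> = (?\<delta> f \<otimes>\<^bsub>B\<^esub> g \<oplus>\<^bsub>B\<^esub> ?\<sigma> f \<otimes>\<^bsub>B\<^esub> ?\<delta> g) \<rho>"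
      using \<rho> B_mult_apply[OF cp_delta_closed[OF f] g \<rho> B_finite_supp[OF f] sub(2) S]
        B_mult_apply[OF cp_sigma_closed[OF f] cp_delta_closed[OF g] \<rho> B_finite_supp[OF f] sub(1) S]
      by (simp add: B_add)
    finally show "?\<delta> (f \<otimes>\<^bsub>B\<^esub> g) \<rho> = (?\<delta> f \<otimes>\<^bsub>B\<^esub> g \<oplus>\<^bsub>B\<^esub> ?\<sigma> f \<otimes>\<^bsub>B\<^esub> ?\<delta> g) \<rho>" .
  qed (simp_all add: cp_delta_eq[OF fg] B_add)
qed

text \<open>Both maps act on single coefficients, so it suffices that \<open>D \<rho>\<close>
  commutes with multiplication by \<open>inv (j \<rho>)\<close>. From
  \<open>\<delta> \<one> = \<zero>\<close> and \<open>\<delta> (j \<rho>) = \<zero>\<close> it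
  follows that \<delta> kills \<open>inv (j \<rho>)\<close>, which the Leibniz rule then lets out of
  \<delta>.\<close>

lemma cp_delta_cp_sigma_commute:
  assumes \<delta>j: "\<And>\<gamma>. \<gamma> \<in> carrier G \<Longrightarrow> \<delta> (j \<gamma>) = \<zero>" and f: "f \<in> carrier B"
  shows "cp_delta A G act j \<delta> s (cp_sigma A G act j f) = cp_sigma A G act j (cp_delta A G act j \<delta> s f)"
proof -
  have "D \<rho> (inv (j \<rho>) \<otimes> a) = inv (j \<rho>) \<otimes> D \<rho> a"
    if \<rho>: "\<rho> \<in> carrier G" and a: "a \<in> carrier A" for \<rho> a
  proof -
    have cl: "j \<rho> \<in> carrier A" "inv (j \<rho>) \<in> carrier A" "j \<rho> \<in> Units A"
      "P \<rho> \<in> carrier A" "Q \<rho> \<in> carrier A"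
      using \<rho> cocycle_unit[OF j] cocycle_closed[OF P_cocycle] cocycle_closed[OF Q_cocycle] by auto
    have "\<zero> = \<delta> (inv (j \<rho>) \<otimes> j \<rho>)"
      using cl by (simp add: \<delta>_one)
    also have "\<dots> = \<delta> (inv (j \<rho>)) \<otimes> j \<rho>"
      using cl \<rho> by (subst \<delta>_mult) (simp_all add: \<delta>j \<delta>_closed)
    finally have "\<zero> = \<delta> (inv (j \<rho>)) \<otimes> j \<rho>" .
    \<comment> \<open>The unit \<open>j \<rho>\<close> is cancelled by multiplying with its inverse
      on the right.\<close>
    from arg_cong[OF this, of "\<lambda>x. x \<otimes> inv (j \<rho>)"] have "\<delta> (inv (j \<rho>)) = \<zero>"
      using cl by (simp add: m_assoc \<delta>_closed)
    then show ?thesis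
      using a cl by (simp add: D_def m_assoc \<delta>_mult[of "inv (j \<rho>)"] \<delta>_closed)
  qed
  then show ?thesis
    using f cp_sigma_closed[OF f] cp_delta_closed[OF f]
    by (auto simp: cp_delta_eq cp_sigma_eq B_apply_closed intro!: restrict_ext)
qed

text \<open>The functional sees only the coefficient at 1, where \<open>P\<close> and
  \<open>Q\<close> equal 1 and \<open>D\<close> is \<delta> itself.\<close>

lemma cp_functional_cp_delta:
  assumes \<tau>: "linear_map A complexes \<tau>" "\<And>a. a \<in> carrier A \<Longrightarrow> \<tau> (\<delta> a) = 0"
    and f: "f \<in> carrier B"
  shows "cp_functional A G \<tau> (cp_delta A G act j \<delta> s f) = 0"
  using cp_functional_apply[OF \<tau>(1) cp_delta_closed[OF f]] B_apply_closed[OF f] \<tau>(2)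
  by (simp add: cp_delta_eq f D_one)

end

end

end

section \<open>The three parts combined\<close>

theorem proposition6p2:
  fixes A :: "(complex, 'a, 'm) module_scheme"
    and G :: "('g, 'n) monoid_scheme"
    and act :: "'a \<Rightarrow> 'g \<Rightarrow> 'a"
    and j :: "'g \<Rightarrow> 'a"
  assumes "complex_algebra A"
    and "group G"
    and "right_action A G act"
    and "one_cocycle A G act j"
  shows
    "algebra_automorphism (crossed_product A G act) (cp_sigma A G act j)
     \<and>
     (\<forall>\<delta>. derivation A \<delta> \<and>
          (\<forall>a\<in>carrier A. \<forall>\<gamma>\<in>carrier G. \<delta> (act a \<gamma>) = act (\<delta> a) \<gamma> \<otimes>\<^bsub>A\<^esub> j \<gamma>) \<longrightarrow>
        (\<forall>s\<ge>1.
           sigma_derivation (crossed_product A G act) (cp_sigma A G act j) (cp_delta A G act j \<delta> s) \<and>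
           ((\<forall>\<gamma>\<in>carrier G. \<delta> (j \<gamma>) = \<zero>\<^bsub>A\<^esub>) \<longrightarrow>
              (\<forall>x\<in>carrier (crossed_product A G act).
                 cp_delta A G act j \<delta> s (cp_sigma A G act j x) =
                 cp_sigma A G act j (cp_delta A G act j \<delta> s x))) \<and>
           (\<forall>\<tau>. alg_trace A \<tau> \<and> (\<forall>a\<in>carrier A. \<tau> (\<delta> a) = 0) \<longrightarrow>
              (\<forall>x\<in>carrier (crossed_product A G act).
                 cp_functional A G \<tau> (cp_delta A G act j \<delta> s x) = 0))))
     \<and>
     (\<forall>\<tau>. alg_trace A \<tau> \<and> change_of_variable A G act j \<tau> \<longrightarrow>
        sigma_trace (crossed_product A G act) (cp_sigma A G act j) (cp_functional A G \<tau>))"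
proof -
  interpret complex_algebra A by fact
  interpret G: group G by fact
  interpret algebra_action A G act
    by unfold_locales fact
  note j = assms(4)
  show ?thesis
    using cp_sigma_automorphism[OF j] cp_delta_sigma_derivation[OF j] cp_delta_cp_sigma_commute[OF j]
      cp_functional_cp_delta[OF j] cp_functional_sigma_trace[OF j]
    by (auto simp: sigma_trace_def)
qed

end
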